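(* Let $C$ and $C'$ be polytopal complexes with $C'\subset C$ such that $C$ collapses to $C'$. Let $D$ be any subdivision of $C$ and let $D'$ be the restriction of $D$ to $|C'|$, i.e. the inclusion-maximal subcomplex of $D$ whose underlying space lies in $|C'|$. Then the derived subdivision $\operatorname{sd}D$ collapses to $\operatorname{sd}D'$ (the derived subdivision of $D'$ induced by $\operatorname{sd}D$, i.e. the restriction of $\operatorname{sd}D$ to $|D'|$).
   Context: Polytopal complexes are geometric (finite collections of convex polytopes in Euclidean space, closed under faces, any two meeting in a common face). A subdivision of $C$ is a polytopal complex $D$ with $|D|=|C|$ each of whose faces is contained in a face of $C$. A derived subdivision $\operatorname{sd}D$ is obtained by stellar subdivisions at all faces in order of decreasing dimension (inserting a vertex in the relative interior of each face and coning). An elementary collapse deletes a free face (a nonempty face strictly contained in exactly one other face); $C$ collapses to $C'$ if $C'$ is obtained from $C$ by a sequence of elementary collapses. *)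

theory Defs
  imports "HOL-Analysis.Analysis"
begin

definition polytopal_complex :: "'a::euclidean_space set set \<Rightarrow> bool" where
  "polytopal_complex C \<longleftrightarrow>
     finite C \<and>
     (\<forall>P\<in>C. polytope P \<and> P \<noteq> {}) \<and>
     (\<forall>P\<in>C. \<forall>F. F face_of P \<and> F \<noteq> {} \<longrightarrow> F \<in> C) \<and>
     (\<forall>P\<in>C. \<forall>Q\<in>C. (P \<inter> Q) face_of P \<and> (P \<inter> Q) face_of Q)"

definition underlying :: "'a::euclidean_space set set \<Rightarrow> 'a set" where
  "underlying C = \<Union>C"

definition subdivision_of :: "'a::euclidean_space set set \<Rightarrow> 'a set set \<Rightarrow> bool" where
  "subdivision_of D C \<longleftrightarrow>
     polytopal_complex D \<and> underlying D = underlying C \<and> (\<forall>F\<in>D. \<exists>G\<in>C. F \<subseteq> G)"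

text \<open>Restriction of a complex to a set X: all faces lying in X
(the inclusion-maximal subcomplex whose underlying space lies in X).\<close>
definition restrict_complex :: "'a::euclidean_space set set \<Rightarrow> 'a set \<Rightarrow> 'a set set" where
  "restrict_complex D X = {F \<in> D. F \<subseteq> X}"

text \<open>Stellar subdivision of K at the face F, inserting the point p (in the relative
interior of F): faces containing F are removed, and the faces of the closed star of F not
containing F are coned from p.\<close>
definition stellar :: "'a::euclidean_space set set \<Rightarrow> 'a set \<Rightarrow> 'a \<Rightarrow> 'a set set" where
  "stellar K F p =
     {G \<in> K. \<not> F \<subseteq> G}
     \<union> {convex hull (insert p G) | G. G \<in> K \<and> \<not> F \<subseteq> G \<and> (\<exists>H\<in>K. F \<subseteq> H \<and> G \<subseteq> H)}
     \<union> {{p}}"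

definition derived_subdivision :: "'a::euclidean_space set set \<Rightarrow> 'a set set \<Rightarrow> bool" where
  "derived_subdivision D S \<longleftrightarrow>
     (\<exists>fs p. distinct fs \<and> set fs = D \<and>
        sorted_wrt (\<lambda>F G. aff_dim G \<le> aff_dim F) fs \<and>
        (\<forall>F\<in>D. p F \<in> rel_interior F) \<and>
        S = foldl (\<lambda>K F. stellar K F (p F)) D fs)"

definition free_face :: "'a::euclidean_space set set \<Rightarrow> 'a set \<Rightarrow> bool" where
  "free_face C \<sigma> \<longleftrightarrow> \<sigma> \<in> C \<and> \<sigma> \<noteq> {} \<and> (\<exists>!\<tau>. \<tau> \<in> C \<and> \<sigma> \<subset> \<tau>)"

definition elementary_collapse :: "'a::euclidean_space set set \<Rightarrow> 'a set set \<Rightarrow> bool" where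
  "elementary_collapse C C' \<longleftrightarrow>
     (\<exists>\<sigma>. free_face C \<sigma> \<and> C' = C - {G \<in> C. \<sigma> \<subseteq> G})"

definition collapses_to :: "'a::euclidean_space set set \<Rightarrow> 'a set set \<Rightarrow> bool" where
  "collapses_to C C' \<longleftrightarrow> elementary_collapse\<^sup>*\<^sup>* C C'"

end

theory Submission
  imports Defs
begin

text \<open>Since \<open>SD\<close> is the order complex of the face poset of \<open>D\<close>, the collapse is a statement about
  chains of cells. It suffices to treat one elementary collapse, removing a face \<open>\<sigma>\<close> of a polytope
  \<open>\<tau>\<close>: the chains of cells in \<open>\<tau>\<close> having a member that meets the relative interior of \<open>\<tau>\<close> or
  of \<open>\<sigma>\<close> have to be paired off. Sweep the cells by their distance from a centre \<open>c\<close>, removing a cell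
  when the shrinking ball around \<open>c\<close> leaves it. If \<open>G\<close> contains its point \<open>x\<close> closest to \<open>c\<close> in its
  relative interior, then what is to be removed with \<open>G\<close> is governed by the cells around \<open>x\<close> that
  enter the open half-space of direction \<open>c - x\<close>; cutting their tangent cones by a hyperplane
  identifies them with a smaller complex of polyhedra, again with convex union, so induction
  applies. In this way every complex of polyhedra with convex union is collapsible, and it
  collapses onto its boundary if some linear form is bounded below on the union and increases along
  a direction of recession. For \<open>\<tau>\<close> itself the centre is taken far away on the inner normal of \<open>\<sigma>\<close>.\<close>

section \<open>Families of sets removable by elementary collapses\<close>

text \<open>A parity count shapes the proof: the simplices off the boundary of a bounded convex
  union have relative Euler characteristic 1 or -1, so their number is odd and they cannot be
  paired. Collapsing onto the boundary is therefore proved under recession, and the induction must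
  reproduce this hypothesis. It does so by an asymmetry at boundary points: if \<open>x\<close> is a
  relative boundary point and the union has points on both sides of the hyperplane through
  \<open>x\<close> orthogonal to \<open>c - x\<close>, then some tangent direction in that
  hyperplane cannot be reversed, and it becomes a direction of recession of the slice. Points on the
  side away from \<open>c\<close> are supplied by placing the centre far out; they also make the
  link nonempty when \<open>x\<close> is interior. Slices stay in the ambient space, so the
  induction is on the number of cells, not on the dimension. A cell whose closest point has a
  smaller carrier needs no induction: adding or deleting the carrier pairs off the chains of its
  group that contain it.\<close>

definition chains_of :: "'a set set \<Rightarrow> 'a set set set" where
  "chains_of M = {c. c \<subseteq> M \<and> (\<forall>F\<in>c. \<forall>G\<in>c. F \<subseteq> G \<or> G \<subseteq> F)}"

text \<open>This depends only on the removed sets and not on the ambient complex. If \<open>X\<close> contains the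
  empty chain, it expresses collapsibility: the last remaining vertex is paired with the empty chain.\<close>

inductive collapses_away :: "'b set set \<Rightarrow> bool" where
  empty: "collapses_away {}"
| step: "\<lbrakk>\<sigma> \<in> X; \<tau> \<in> X; \<sigma> \<subset> \<tau>; \<And>\<rho>. \<lbrakk>\<rho> \<in> X; \<sigma> \<subseteq> \<rho>\<rbrakk> \<Longrightarrow> \<rho> = \<sigma> \<or> \<rho> = \<tau>;
          collapses_away (X - {\<sigma>, \<tau>})\<rbrakk> \<Longrightarrow> collapses_away X"

section \<open>Chains of sets and their extreme members\<close>

lemma chains_ofI:
  "\<lbrakk>c \<subseteq> M; \<And>F G. \<lbrakk>F \<in> c; G \<in> c\<rbrakk> \<Longrightarrow> F \<subseteq> G \<or> G \<subseteq> F\<rbrakk> \<Longrightarrow> c \<in> chains_of M"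
  by (simp add: chains_of_def)

lemma chains_ofD:
  assumes "c \<in> chains_of M"
  shows "c \<subseteq> M" "\<lbrakk>F \<in> c; G \<in> c\<rbrakk> \<Longrightarrow> F \<subseteq> G \<or> G \<subseteq> F"
  using assms by (simp_all add: chains_of_def)

lemma chains_of_subset:
  assumes "c \<in> chains_of M" "c' \<subseteq> c"
  shows "c' \<in> chains_of M"
proof (rule chains_ofI)
  show "c' \<subseteq> M"
    using assms chains_ofD(1) by fast
  show "F \<subseteq> G \<or> G \<subseteq> F" if "F \<in> c'" "G \<in> c'" for F G
    using chains_ofD(2)[OF assms(1), of F G] that assms(2) by fast
qed

lemma finite_chains_of: "finite M \<Longrightarrow> finite (chains_of M)"
  unfolding chains_of_def by simp

lemma finite_chain: "\<lbrakk>finite M; c \<in> chains_of M\<rbrakk> \<Longrightarrow> finite c"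
  using finite_subset[of c M] by (simp add: chains_of_def)

lemma Inter_in_chain:
  assumes "finite c" "c \<noteq> {}" "c \<in> chains_of M"
  shows "\<Inter>c \<in> c"
  using assms
proof (induction c rule: finite_ne_induct)
  case (insert F c)
  have "c \<in> chains_of M"
    using chains_of_subset[OF insert.prems] by blast
  then have "\<Inter>c \<in> c"
    using insert.IH by simp
  then have "F \<subseteq> \<Inter>c \<or> \<Inter>c \<subseteq> F"
    using insert.prems unfolding chains_of_def by simp
  then have "F \<inter> \<Inter>c = F \<or> F \<inter> \<Inter>c = \<Inter>c"
    by blast
  then show ?case
    using \<open>\<Inter>c \<in> c\<close> by (elim disjE) simp_all
qed simp

lemma Union_in_chain:
  assumes "finite c" "c \<noteq> {}" "c \<in> chains_of M"
  shows "\<Union>c \<in> c"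
  using assms
proof (induction c rule: finite_ne_induct)
  case (insert F c)
  have "c \<in> chains_of M"
    using chains_of_subset[OF insert.prems] by blast
  then have "\<Union>c \<in> c"
    using insert.IH by simp
  then have "F \<subseteq> \<Union>c \<or> \<Union>c \<subseteq> F"
    using insert.prems unfolding chains_of_def by simp
  then have "F \<union> \<Union>c = F \<or> F \<union> \<Union>c = \<Union>c"
    by blast
  then show ?case
    using \<open>\<Union>c \<in> c\<close> by (elim disjE) simp_all
qed simp

section \<open>Composing and transporting collapses\<close>

text \<open>\<open>Y\<close> is removed first. No member of \<open>Y\<close> lies below a member of
  \<open>Z\<close>, so adjoining \<open>Z\<close> puts nothing new above a free face of
  \<open>Y\<close>.\<close>

lemma collapses_away_Un:
  assumes "collapses_away Y" "collapses_away Z" "Y \<inter> Z = {}"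
    and "\<And>y z. \<lbrakk>y \<in> Y; z \<in> Z\<rbrakk> \<Longrightarrow> \<not> y \<subseteq> z"
  shows "collapses_away (Y \<union> Z)"
  using assms
proof (induction Y rule: collapses_away.induct)
  case (step \<sigma> X \<tau>)
  have "collapses_away ((X - {\<sigma>, \<tau>}) \<union> Z)"
    by (rule step.IH) (use step.prems in auto)
  moreover have "(X - {\<sigma>, \<tau>}) \<union> Z = (X \<union> Z) - {\<sigma>, \<tau>}"
    using step.hyps step.prems by blast
  ultimately have "collapses_away ((X \<union> Z) - {\<sigma>, \<tau>})"
    by metis
  then show ?case
    by (rule collapses_away.step[rotated 4]) (use step.hyps step.prems in blast)+
qed simp

text \<open>The patchwork principle of discrete Morse theory. A fibre of largest rank is removed
  first: by \<open>mono\<close> and \<open>strict\<close> none of its members lies below a member of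
  another fibre.\<close>

lemma collapses_away_fibres:
  fixes h :: "'b set \<Rightarrow> 'i" and r :: "'i \<Rightarrow> 'k::linorder"
  assumes "finite X"
    and mono: "\<And>c c'. \<lbrakk>c \<in> X; c' \<in> X; c \<subseteq> c'\<rbrakk> \<Longrightarrow> r (h c) \<le> r (h c')"
    and strict: "\<And>c c'. \<lbrakk>c \<in> X; c' \<in> X; c \<subseteq> c'; r (h c) = r (h c')\<rbrakk> \<Longrightarrow> h c = h c'"
    and fibre: "\<And>i. i \<in> h ` X \<Longrightarrow> collapses_away {c \<in> X. h c = i}"
  shows "collapses_away X"
  using assms
proof (induction "card (h ` X)" arbitrary: X)
  case 0
  then show ?case
    by (simp add: collapses_away.empty)
next
  case (Suc n)
  have fin: "finite (r ` h ` X)" and ne: "r ` h ` X \<noteq> {}"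
    using Suc.prems(1) Suc.hyps(2) by auto
  obtain i where i: "i \<in> h ` X" "r i = Max (r ` h ` X)"
    using Max_in[OF fin ne] by (metis imageE)
  have max: "r j \<le> r i" if "j \<in> h ` X" for j
    using that i fin by simp
  define Y where "Y = {c \<in> X. h c = i}"
  have "h ` (X - Y) = h ` X - {i}"
    unfolding Y_def by auto
  then have card: "n = card (h ` (X - Y))"
    using Suc.hyps(2) i(1) Suc.prems(1) by (simp add: card_Diff_singleton)
  have "{c \<in> X - Y. h c = j} = {c \<in> X. h c = j}" if "j \<in> h ` (X - Y)" for j
    using that by (auto simp: Y_def)
  then have 1: "collapses_away (X - Y)"
    using Suc.prems by (intro Suc.hyps(1)[OF card]) auto
  have 2: "\<not> y \<subseteq> z" if "y \<in> Y" "z \<in> X - Y" for y z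
  proof
    assume "y \<subseteq> z"
    moreover have "y \<in> X" "z \<in> X" "h y = i"
      using that Y_def by auto
    ultimately have "r (h y) = r (h z)"
      using Suc.prems(2)[of y z] max[of "h z"] by (simp add: order_antisym)
    then show False
      using Suc.prems(3)[of y z] \<open>y \<subseteq> z\<close> that Y_def by auto
  qed
  have "collapses_away (Y \<union> (X - Y))"
    using Suc.prems(4)[OF i(1)] 1 2 by (intro collapses_away_Un) (auto simp: Y_def)
  moreover have "Y \<union> (X - Y) = X"
    by (auto simp: Y_def)
  ultimately show ?case
    by simp
qed

text \<open>Freeness involves only inclusions among members of \<open>X\<close>, so a map preserving
  and reflecting these carries the pairing along.\<close>

lemma collapses_away_image:
  assumes "collapses_away X"
    and "\<And>a b. \<lbrakk>a \<in> X; b \<in> X\<rbrakk> \<Longrightarrow> f a \<subseteq> f b \<longleftrightarrow> a \<subseteq> b"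
  shows "collapses_away (f ` X)"
  using assms
proof (induction X rule: collapses_away.induct)
  case (step \<sigma> X \<tau>)
  note iff = step.prems
  have inj: "a = b" if "a \<in> X" "b \<in> X" "f a = f b" for a b
    using iff that by (metis subset_antisym subset_refl)
  have "collapses_away (f ` (X - {\<sigma>, \<tau>}))"
    by (rule step.IH) (use iff in auto)
  moreover have "f ` (X - {\<sigma>, \<tau>}) = f ` X - {f \<sigma>, f \<tau>}"
    using inj step.hyps(1,2) by auto
  ultimately have ca: "collapses_away (f ` X - {f \<sigma>, f \<tau>})"
    by metis
  have ss: "f \<sigma> \<subset> f \<tau>"
    using iff inj step.hyps(1-3) by (metis psubset_eq)
  show ?case
  proof (rule collapses_away.step[OF _ _ ss _ ca])
    fix \<rho> assume "\<rho> \<in> f ` X" "f \<sigma> \<subseteq> \<rho>"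
    then show "\<rho> = f \<sigma> \<or> \<rho> = f \<tau>"
      using iff step.hyps(1,4) by (metis imageE)
  qed (use step.hyps in auto)
qed (simp add: collapses_away.empty)

text \<open>The pairs are \<open>c\<close> and \<open>insert v c\<close>. Beginning with a maximal
  \<open>c\<close> avoiding \<open>v\<close> makes the pair free, and its removal preserves both
  closure conditions.\<close>

lemma collapses_away_cone:
  assumes "finite X"
    and "\<And>c. c \<in> X \<Longrightarrow> insert v c \<in> X" "\<And>c. c \<in> X \<Longrightarrow> c - {v} \<in> X"
  shows "collapses_away X"
  using assms
proof (induction "card X" arbitrary: X rule: less_induct)
  case less
  show ?case
  proof (cases "X = {}")
    case False
    then have "finite {c \<in> X. v \<notin> c}" "{c \<in> X. v \<notin> c} \<noteq> {}"
      using less.prems by auto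
    then obtain \<sigma> where \<sigma>: "\<sigma> \<in> X" "v \<notin> \<sigma>"
      and max: "\<And>c. \<lbrakk>c \<in> X; v \<notin> c; \<sigma> \<subseteq> c\<rbrakk> \<Longrightarrow> c = \<sigma>"
      using finite_has_maximal[of "{c \<in> X. v \<notin> c}"] by (smt (verit) mem_Collect_eq)
    let ?\<tau> = "insert v \<sigma>"
    have free: "\<rho> = \<sigma> \<or> \<rho> = ?\<tau>" if "\<rho> \<in> X" "\<sigma> \<subseteq> \<rho>" for \<rho>
      using max[of "\<rho> - {v}"] less.prems(3) that \<sigma> by blast
    have "collapses_away (X - {\<sigma>, ?\<tau>})"
    proof (rule less.hyps)
      show "card (X - {\<sigma>, ?\<tau>}) < card X"
        using \<sigma> less.prems(1) by (intro psubset_card_mono) auto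
      fix c assume "c \<in> X - {\<sigma>, ?\<tau>}"
      moreover have "c = \<sigma> \<or> c = ?\<tau>" if "insert v c = insert v \<sigma>"
        using that \<sigma>(2) by (metis insert_absorb insert_ident)
      moreover have "c = \<sigma> \<or> c = ?\<tau>" if "c - {v} = \<sigma>"
        using that by blast
      ultimately show "insert v c \<in> X - {\<sigma>, ?\<tau>}" "c - {v} \<in> X - {\<sigma>, ?\<tau>}"
        using less.prems(2,3) \<sigma>(2) by auto
    qed (use less.prems in auto)
    then show ?thesis
      using free \<sigma> less.prems(2) by (intro collapses_away.step[of \<sigma> X ?\<tau>]) auto
  qed (simp add: collapses_away.empty)
qed

lemma collapses_away_join:
  assumes "collapses_away Y" "\<And>b. b \<in> Y \<Longrightarrow> a \<inter> b = {}"
  shows "collapses_away ((\<union>) a ` Y)"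
  by (rule collapses_away_image[OF assms(1)]) (use assms(2) in blast)

text \<open>An order isomorphism induces one on chains. \<open>Q\<close> speaks about the image
  because the interior condition is established for slices and then pulled back to cells.\<close>

lemma collapses_away_chains_image:
  assumes "collapses_away {c \<in> chains_of (S ` L). Q c}"
    and iff: "\<And>F G. \<lbrakk>F \<in> L; G \<in> L\<rbrakk> \<Longrightarrow> S F \<subseteq> S G \<longleftrightarrow> F \<subseteq> G"
  shows "collapses_away {c \<in> chains_of L. Q (S ` c)}"
proof -
  have inj: "inj_on S L"
    using iff by (auto simp: inj_on_def)
  define T where "T = inv_into L S"
  have TS: "T (S F) = F" if "F \<in> L" for F
    using that inj by (simp add: T_def)
  have ST: "S ` T ` c = c" "T ` c \<in> chains_of L" if "c \<in> chains_of (S ` L)" for c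
  proof -
    have "c \<subseteq> S ` L"
      using that by (simp add: chains_of_def)
    then obtain b where b: "b \<subseteq> L" "c = S ` b"
      by (auto simp: subset_image_iff)
    have "T ` c = b"
    proof -
      have "T ` c = (\<lambda>F. T (S F)) ` b"
        by (simp only: b(2) image_image)
      also have "\<dots> = (\<lambda>F. F) ` b"
        by (rule image_cong) (use TS b(1) in auto)
      finally show ?thesis
        by simp
    qed
    moreover have "F \<subseteq> G \<or> G \<subseteq> F" if "F \<in> b" "G \<in> b" for F G
      using chains_ofD(2)[OF \<open>c \<in> chains_of (S ` L)\<close>, of "S F" "S G"] that b iff[of F G] iff[of G F] by fast
    then have "b \<in> chains_of L"
      using b(1) by (intro chains_ofI)
    ultimately show "S ` T ` c = c" "T ` c \<in> chains_of L"
      using b(2) by metis+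
  qed
  have "{c \<in> chains_of L. Q (S ` c)} = (`) T ` {c \<in> chains_of (S ` L). Q c}"
  proof (intro equalityI subsetI)
    fix c assume c: "c \<in> {c \<in> chains_of L. Q (S ` c)}"
    then have "c \<subseteq> L"
      by (simp add: chains_of_def)
    then have "T ` S ` c = c"
    proof -
      have "T ` S ` c = (\<lambda>F. T (S F)) ` c"
        by (simp only: image_image)
      also have "\<dots> = (\<lambda>F. F) ` c"
        by (rule image_cong) (use TS \<open>c \<subseteq> L\<close> in auto)
      finally show ?thesis
        by simp
    qed
    moreover have "S F \<subseteq> S G \<or> S G \<subseteq> S F" if "F \<in> c" "G \<in> c" for F G
      using chains_ofD(2)[of c L F G] c that iff[of F G] iff[of G F] \<open>c \<subseteq> L\<close> by fast
    then have "S ` c \<in> chains_of (S ` L)"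
      using \<open>c \<subseteq> L\<close> by (intro chains_ofI) auto
    ultimately show "c \<in> (`) T ` {c \<in> chains_of (S ` L). Q c}"
      using c by (intro image_eqI[of _ _ "S ` c"]) auto
  qed (use ST in auto)
  moreover have "collapses_away ((`) T ` {c \<in> chains_of (S ` L). Q c})"
  proof (rule collapses_away_image[OF assms(1)])
    fix a b assume "a \<in> {c \<in> chains_of (S ` L). Q c}" "b \<in> {c \<in> chains_of (S ` L). Q c}"
    then have "a = S ` T ` a" "b = S ` T ` b"
      using ST(1) by simp_all
    then show "T ` a \<subseteq> T ` b \<longleftrightarrow> a \<subseteq> b"
      by (metis image_mono)
  qed
  ultimately show ?thesis
    by simp
qed

text \<open>Here \<open>m F\<close> stands for the distance of \<open>F\<close> from a centre and
  \<open>\<kappa> F\<close> for the carrier of its closest point. Chains are grouped by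
  \<open>\<kappa>\<close> of their least member. In the group of \<open>G\<close>, the chains with a
  member other than \<open>G\<close> that has the same \<open>\<kappa>\<close> form a cone with apex
  \<open>G\<close>; every other chain is \<open>G\<close> joined to a chain of strictly nearer cells
  above \<open>G\<close>, and these are left to \<open>link\<close>.\<close>

lemma collapses_away_sweep:
  fixes m :: "'a set \<Rightarrow> real"
  assumes "finite N" and J: "J \<subseteq> chains_of N - {{}}"
    and \<kappa>: "\<And>F. F \<in> N \<Longrightarrow> \<kappa> F \<in> N \<and> \<kappa> F \<subseteq> F \<and> m (\<kappa> F) = m F \<and> \<kappa> (\<kappa> F) = \<kappa> F"
    and mono: "\<And>F G. \<lbrakk>F \<in> N; G \<in> N; F \<subseteq> G\<rbrakk> \<Longrightarrow> m G \<le> m F"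
    and strict: "\<And>F G. \<lbrakk>F \<in> N; G \<in> N; F \<subseteq> G; m F = m G\<rbrakk> \<Longrightarrow> \<kappa> F = \<kappa> G"
    and up: "\<And>c G. \<lbrakk>c \<in> J; insert G c \<in> chains_of N\<rbrakk> \<Longrightarrow> insert G c \<in> J"
    and down: "\<And>c F. \<lbrakk>c \<in> J; F \<in> c; F \<noteq> \<kappa> F\<rbrakk> \<Longrightarrow> c - {\<kappa> F} \<in> J"
    and link: "\<And>G. \<lbrakk>G \<in> N; \<kappa> G = G\<rbrakk> \<Longrightarrow>
      collapses_away {b \<in> chains_of {F \<in> N. G \<subset> F \<and> m F < m G}. insert G b \<in> J}"
  shows "collapses_away J"
proof -
  have bot: "\<Inter>c \<in> c" "\<Inter>c \<in> N" "finite c" "c \<subseteq> N" "c \<in> chains_of N" if "c \<in> J" for c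
  proof -
    show *: "finite c" "c \<in> chains_of N"
      using that J finite_chain \<open>finite N\<close> by auto
    then show "\<Inter>c \<in> c"
      using that J by (intro Inter_in_chain) auto
    then show "\<Inter>c \<in> N" "c \<subseteq> N"
      using * by (auto simp: chains_of_def)
  qed
  show ?thesis
  \<comment> \<open>A larger chain has a smaller least member, hence a larger \<open>m\<close>; so
    the groups of the farthest cells are removed first.\<close>
  proof (rule collapses_away_fibres[where h = "\<lambda>c. \<kappa> (\<Inter>c)" and r = m])
  show "finite J"
    using \<open>finite N\<close> J finite_chains_of finite_subset by blast
  fix c c' assume c: "c \<in> J" "c' \<in> J" "c \<subseteq> c'"
  then have le: "\<Inter>c' \<subseteq> \<Inter>c"
    by (simp add: Inter_anti_mono)
  have m: "m (\<kappa> (\<Inter>c)) = m (\<Inter>c)" "m (\<kappa> (\<Inter>c')) = m (\<Inter>c')"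
    using \<kappa> bot(2) c by simp_all
  show "m (\<kappa> (\<Inter>c)) \<le> m (\<kappa> (\<Inter>c'))"
    using mono[OF _ _ le] bot(2) c m by simp
  show "m (\<kappa> (\<Inter>c)) = m (\<kappa> (\<Inter>c')) \<Longrightarrow> \<kappa> (\<Inter>c) = \<kappa> (\<Inter>c')"
    using strict[OF _ _ le] bot(2) c m by simp
next
  fix G assume "G \<in> (\<lambda>c. \<kappa> (\<Inter>c)) ` J"
  then have G: "G \<in> N" "\<kappa> G = G"
    using \<kappa> bot by auto
  let ?X = "{c \<in> J. \<kappa> (\<Inter>c) = G}"
  define Y where "Y = {c \<in> ?X. \<exists>F\<in>c. F \<noteq> G \<and> \<kappa> F = G}"
  have "finite J"
    using \<open>finite N\<close> J finite_chains_of finite_subset by blast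
  have "collapses_away Y"
  proof (rule collapses_away_cone)
    show "finite Y"
      using \<open>finite J\<close> by (simp add: Y_def)
    fix c assume "c \<in> Y"
    then obtain F where c: "c \<in> J" "\<kappa> (\<Inter>c) = G" and F: "F \<in> c" "F \<noteq> G" "\<kappa> F = G"
      by (auto simp: Y_def)
    have Gc: "G \<subseteq> \<Inter>c"
      using c \<kappa> bot by metis
    have "insert G c \<in> chains_of N"
    proof (rule chains_ofI)
      show "F \<subseteq> F' \<or> F' \<subseteq> F" if "F \<in> insert G c" "F' \<in> insert G c" for F F'
        using that Gc chains_ofD(2)[OF bot(5)[OF c(1)], of F F'] by blast
    qed (use bot(4)[OF c(1)] G in simp)
    then have "insert G c \<in> J"
      using up c by blast
    moreover have "\<Inter>(insert G c) = G"
      using Gc by blast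
    ultimately show "insert G c \<in> Y"
      using F G by (auto simp: Y_def)
    have cJ: "c - {G} \<in> J"
      using down[OF c(1) F(1)] F by auto
    \<comment> \<open>After deleting \<open>G\<close> the least member lies between
      \<open>\<Inter>c\<close> and \<open>F\<close>, on which \<open>m\<close> takes the same value;
      so its \<open>\<kappa>\<close> is still \<open>G\<close>.\<close>
    let ?B = "\<Inter>(c - {G})"
    have "?B \<in> N" "?B \<subseteq> F" "\<Inter>c \<subseteq> ?B" "F \<in> N"
      using bot(2)[OF cJ] F bot(4)[OF c(1)] by auto
    moreover have "m F = m (\<Inter>c)"
      using \<kappa> F c bot calculation by metis
    ultimately have "\<kappa> ?B = \<kappa> F"
      using mono strict bot c by (metis order_antisym)
    then show "c - {G} \<in> Y"
      using cJ F by (auto simp: Y_def)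
  qed
  moreover have "collapses_away (?X - Y)"
  proof -
    let ?L = "{F \<in> N. G \<subset> F \<and> m F < m G}"
    have "?X - Y = (\<union>) {G} ` {b \<in> chains_of ?L. insert G b \<in> J}"
    proof (intro equalityI subsetI)
      fix c assume "c \<in> ?X - Y"
      then have c: "c \<in> J" "\<kappa> (\<Inter>c) = G" and only: "\<And>F. \<lbrakk>F \<in> c; \<kappa> F = G\<rbrakk> \<Longrightarrow> F = G"
        by (auto simp: Y_def)
      then have "\<Inter>c = G"
        using bot(1) by simp
      then have Gc: "\<Inter>c = G" "G \<in> c"
        using bot(1)[OF c(1)] by simp_all
      have "F \<in> ?L" if "F \<in> c - {G}" for F
      proof -
        have *: "F \<in> N" "G \<subset> F"
          using that Gc bot(4) c by auto
        then have "m F \<le> m G"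
          using mono G by auto
        moreover have "m F \<noteq> m G"
          using strict[of G F] * G only[of F] that by auto
        ultimately show ?thesis
          using * by auto
      qed
      then have "c - {G} \<in> chains_of ?L"
        using chains_ofD(2)[OF bot(5)[OF c(1)]] by (intro chains_ofI) auto
      moreover have "c = {G} \<union> (c - {G})" "insert G (c - {G}) = c"
        using Gc by auto
      ultimately show "c \<in> (\<union>) {G} ` {b \<in> chains_of ?L. insert G b \<in> J}"
        using c by (metis (no_types, lifting) imageI mem_Collect_eq)
    next
      fix c assume "c \<in> (\<union>) {G} ` {b \<in> chains_of ?L. insert G b \<in> J}"
      then obtain b where b: "b \<in> chains_of ?L" "insert G b \<in> J" "c = insert G b"
        by auto
      have bL: "F \<in> N \<and> G \<subset> F \<and> m F < m G" if "F \<in> b" for F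
        using that chains_ofD(1)[OF b(1)] by blast
      then have "\<Inter>c = G"
        using b(3) by blast
      moreover have "F = G" if "F \<in> c" "\<kappa> F = G" for F
        using that bL \<kappa> b(3) by (metis insertE less_irrefl)
      ultimately show "c \<in> ?X - Y"
        using b G by (auto simp: Y_def)
    qed
    moreover have "collapses_away ((\<union>) {G} ` {b \<in> chains_of ?L. insert G b \<in> J})"
      by (rule collapses_away_join[OF link[OF G]]) (use chains_ofD(1) in fast)
    ultimately show ?thesis
      by simp
  qed
  ultimately have "collapses_away (Y \<union> (?X - Y))"
    by (rule collapses_away_Un) (auto simp: Y_def)
  moreover have "Y \<union> (?X - Y) = ?X"
    by (auto simp: Y_def)
  ultimately show "collapses_away ?X"
    by simp
  qed
qed

text \<open>As \<open>Y\<close> is an upper set of \<open>K\<close>, everything in \<open>K\<close>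
  above a free face of \<open>Y\<close> is in \<open>Y\<close>; each pair is then an elementary
  collapse of what is left of \<open>K\<close>.\<close>

lemma collapses_to_if_collapses_away:
  assumes "collapses_away Y" "Y \<subseteq> K" "{} \<notin> Y"
    and "\<And>G H. \<lbrakk>G \<in> Y; H \<in> K; G \<subseteq> H\<rbrakk> \<Longrightarrow> H \<in> Y"
  shows "collapses_to K (K - Y)"
  using assms
proof (induction Y arbitrary: K rule: collapses_away.induct)
  case empty
  then show ?case
    by (simp add: collapses_to_def)
next
  case (step \<sigma> X \<tau>)
  have up: "G = \<sigma> \<or> G = \<tau>" if "G \<in> K" "\<sigma> \<subseteq> G" for G
    using step.hyps(1,4) step.prems(3) that by blast
  have in_K: "\<sigma> \<in> K" "\<tau> \<in> K" "\<sigma> \<noteq> {}"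
    using step.hyps(1,2) step.prems(1,2) by auto
  then have "{G \<in> K. \<sigma> \<subseteq> G} = {\<sigma>, \<tau>}"
    using up \<open>\<sigma> \<subset> \<tau>\<close> by auto
  moreover have "free_face K \<sigma>"
    unfolding free_face_def using up in_K \<open>\<sigma> \<subset> \<tau>\<close> by (intro conjI ex1I[of _ \<tau>]) auto
  ultimately have "elementary_collapse K (K - {\<sigma>, \<tau>})"
    unfolding elementary_collapse_def by metis
  moreover have "collapses_to (K - {\<sigma>, \<tau>}) (K - {\<sigma>, \<tau>} - (X - {\<sigma>, \<tau>}))"
  proof (rule step.IH)
    show "H \<in> X - {\<sigma>, \<tau>}" if "G \<in> X - {\<sigma>, \<tau>}" "H \<in> K - {\<sigma>, \<tau>}" "G \<subseteq> H" for G H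
      using that step.prems(3)[of G H] by blast
  qed (use step.prems(1,2) in auto)
  moreover have "K - {\<sigma>, \<tau>} - (X - {\<sigma>, \<tau>}) = K - X"
    using step.hyps(1,2) by blast
  ultimately show ?case
    unfolding collapses_to_def by (simp add: converse_rtranclp_into_rtranclp)
qed

section \<open>Complexes of polyhedra and their slices\<close>

text \<open>The face-to-face condition in the form the sweep uses: each point of the union has a
  carrier, and the carrier lies in every cell through the point. The cells are polyhedra because
  slices of tangent cones may be unbounded.\<close>

definition cell_complex :: "'a::euclidean_space set set \<Rightarrow> bool" where
  "cell_complex M \<longleftrightarrow>
     finite M \<and> (\<forall>F\<in>M. polyhedron F \<and> F \<noteq> {}) \<and>
     (\<forall>F\<in>M. \<forall>G\<in>M. rel_interior F \<inter> G \<noteq> {} \<longrightarrow> F \<subseteq> G) \<and>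
     (\<forall>G\<in>M. \<forall>x\<in>G. \<exists>F\<in>M. x \<in> rel_interior F)"

definition tangent_cone :: "'a::euclidean_space \<Rightarrow> 'a set \<Rightarrow> 'a set" where
  "tangent_cone x S = {y. \<exists>e>0. x + e *\<^sub>R y \<in> S}"

text \<open>A cross-section of the part of the tangent cone in the open half-space where
  \<open>w\<close> is positive. Cutting at level 1 yields sets of the same type again, so the
  results on complexes apply to slices.\<close>

definition slice :: "'a::euclidean_space \<Rightarrow> 'a \<Rightarrow> 'a set \<Rightarrow> 'a set" where
  "slice x w S = tangent_cone x S \<inter> {y. w \<bullet> y = 1}"

definition open_link :: "'a::euclidean_space \<Rightarrow> 'a \<Rightarrow> 'a set set \<Rightarrow> 'a set set" where
  "open_link x w M = {F \<in> M. x \<in> F \<and> (\<exists>y\<in>F. 0 < w \<bullet> (y - x))}"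

lemma cell_complexD:
  assumes "cell_complex M"
  shows "finite M"
    and "F \<in> M \<Longrightarrow> polyhedron F" "F \<in> M \<Longrightarrow> convex F" "F \<in> M \<Longrightarrow> closed F" "F \<in> M \<Longrightarrow> F \<noteq> {}"
    and "\<lbrakk>F \<in> M; G \<in> M; x \<in> rel_interior F; x \<in> G\<rbrakk> \<Longrightarrow> F \<subseteq> G"
    and "\<lbrakk>G \<in> M; x \<in> G\<rbrakk> \<Longrightarrow> \<exists>F\<in>M. x \<in> rel_interior F"
  using assms unfolding cell_complex_def
  by (auto intro: polyhedron_imp_convex polyhedron_imp_closed)

lemma carrier_unique:
  assumes "cell_complex M" "F \<in> M" "G \<in> M" "x \<in> rel_interior F" "x \<in> rel_interior G"
  shows "F = G"
  using assms cell_complexD(6) rel_interior_subset by (metis subsetD subset_antisym)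

lemma segment_in_convex:
  assumes "convex F" "x \<in> F" "x + e *\<^sub>R y \<in> F" "0 < d" "d \<le> e"
  shows "x + d *\<^sub>R y \<in> F"
proof -
  have "(1 - d/e) *\<^sub>R x + (d/e) *\<^sub>R (x + e *\<^sub>R y) \<in> F"
    by (rule convexD[OF assms(1-3)]) (use assms in auto)
  also have "(1 - d/e) *\<^sub>R x + (d/e) *\<^sub>R (x + e *\<^sub>R y) = x + d *\<^sub>R y"
    using assms by (simp add: algebra_simps)
  finally show ?thesis .
qed

lemma segment_in_rel_interior:
  fixes F :: "'a::euclidean_space set"
  assumes "convex F" "x \<in> F" "x + e *\<^sub>R y \<in> rel_interior F" "0 < d" "d \<le> e"
  shows "x + d *\<^sub>R y \<in> rel_interior F"
  using rel_interior_convex_shrink[OF assms(1,3,2), of "d/e"] assms by simp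

text \<open>Among the points at parameters \<open>d / (n + 1)\<close> infinitely many share a
  carrier by the pigeonhole principle; they converge to \<open>x\<close>, so this closed cell
  contains \<open>x\<close> as well.\<close>

lemma germ_in_cell:
  assumes M: "cell_complex M" and "0 < d"
    and ray: "\<And>s. \<lbrakk>0 < s; s \<le> d\<rbrakk> \<Longrightarrow> x + s *\<^sub>R y \<in> \<Union>M"
  obtains F s where "F \<in> M" "x \<in> F" "0 < s" "s \<le> d" "x + s *\<^sub>R y \<in> rel_interior F"
proof -
  define t where "t n = d / (real n + 1)" for n
  have t: "0 < t n" "t n \<le> d" for n
    using \<open>0 < d\<close> by (simp_all add: t_def divide_simps)
  have "\<exists>F\<in>M. x + t n *\<^sub>R y \<in> rel_interior F" for n
    using ray[OF t] cell_complexD(7)[OF M] by blast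
  then obtain F where F: "\<And>n. F n \<in> M" "\<And>n. x + t n *\<^sub>R y \<in> rel_interior (F n)"
    by metis
  have "finite (range F)"
    using F(1) cell_complexD(1)[OF M] by (meson finite_subset image_subsetI)
  then obtain k where inf: "infinite {n. F n = F k}"
    using pigeonhole_infinite[of UNIV F] by auto
  have "x \<in> closure (F k)"
    unfolding closure_approachable
  proof (intro allI impI)
    fix e :: real assume "0 < e"
    obtain N :: nat where N: "d * norm y / e < N"
      using reals_Archimedean2 by blast
    obtain n where n: "N < n" "F n = F k"
      using inf unfolding infinite_nat_iff_unbounded by blast
    have "d * norm y < real N * e"
      using N \<open>0 < e\<close> by (simp add: divide_simps)
    also have "\<dots> \<le> (real n + 1) * e"
      using n \<open>0 < e\<close> by (intro mult_right_mono) auto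
    finally have "t n * norm y < e"
      by (simp add: t_def divide_simps mult.commute)
    moreover have "dist (x + t n *\<^sub>R y) x = t n * norm y"
      using t(1)[of n] by (simp add: dist_norm)
    ultimately show "\<exists>z\<in>F k. dist z x < e"
      using F(2)[of n] n rel_interior_subset by (metis subsetD)
  qed
  then have "x \<in> F k"
    using cell_complexD(4)[OF M F(1)] by simp
  then show ?thesis
    using that F t by blast
qed

section \<open>Tangent cones\<close>

lemma tangent_coneI: "\<lbrakk>0 < e; x + e *\<^sub>R y \<in> S\<rbrakk> \<Longrightarrow> y \<in> tangent_cone x S"
  unfolding tangent_cone_def by blast

lemma tangent_cone_diff: "z \<in> S \<Longrightarrow> z - x \<in> tangent_cone x S"
  by (rule tangent_coneI[of 1]) auto

lemma tangent_cone_mono: "S \<subseteq> T \<Longrightarrow> tangent_cone x S \<subseteq> tangent_cone x T"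
  by (auto simp: tangent_cone_def)

lemma tangent_cone_scale:
  assumes "x \<in> S" "y \<in> tangent_cone x S" "0 \<le> c"
  shows "c *\<^sub>R y \<in> tangent_cone x S"
proof -
  obtain e where e: "0 < e" "x + e *\<^sub>R y \<in> S"
    using assms by (auto simp: tangent_cone_def)
  show ?thesis
  proof (cases "c = 0")
    case True
    then show ?thesis
      using tangent_coneI[of 1 x 0 S] assms(1) by simp
  next
    case False
    then show ?thesis
      using tangent_coneI[of "e/c" x "c *\<^sub>R y" S] e assms(3) by simp
  qed
qed

lemma tangent_cone_add:
  assumes "convex S" "x \<in> S" "y \<in> tangent_cone x S" "z \<in> tangent_cone x S"
  shows "y + z \<in> tangent_cone x S"
proof -
  obtain d e where de: "0 < d" "x + d *\<^sub>R y \<in> S" "0 < e" "x + e *\<^sub>R z \<in> S"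
    using assms by (auto simp: tangent_cone_def)
  let ?m = "min d e"
  have "x + ?m *\<^sub>R y \<in> S" "x + ?m *\<^sub>R z \<in> S"
    using de assms(1,2) by (auto intro: segment_in_convex)
  then have "(1/2) *\<^sub>R (x + ?m *\<^sub>R y) + (1/2) *\<^sub>R (x + ?m *\<^sub>R z) \<in> S"
    by (intro convexD[OF assms(1)]) auto
  also have "(1/2) *\<^sub>R (x + ?m *\<^sub>R y) + (1/2) *\<^sub>R (x + ?m *\<^sub>R z) = x + (?m/2) *\<^sub>R (y + z)"
    by (simp add: algebra_simps flip: scaleR_left.add)
  finally show ?thesis
    using de by (intro tangent_coneI[of "?m/2"]) auto
qed

lemma convex_tangent_cone: "\<lbrakk>convex S; x \<in> S\<rbrakk> \<Longrightarrow> convex (tangent_cone x S)"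
  by (rule convexI) (simp add: tangent_cone_add tangent_cone_scale)

text \<open>Only half-spaces with \<open>x\<close> on their bounding hyperplane restrict a
  direction; the other constraints are strict at \<open>x\<close> and survive a short step.\<close>

lemma polyhedron_tangent_cone:
  assumes "polyhedron S" "x \<in> S"
  shows "polyhedron (tangent_cone x S)"
proof -
  obtain H where H: "finite H" "S = \<Inter>H" and "\<forall>h\<in>H. \<exists>a b. a \<noteq> 0 \<and> h = {z. a \<bullet> z \<le> b}"
    using assms(1) unfolding polyhedron_def by blast
  then obtain a b where ab: "\<And>h. h \<in> H \<Longrightarrow> h = {z. a h \<bullet> z \<le> b h}"
    by metis
  have mem: "z \<in> h \<longleftrightarrow> a h \<bullet> z \<le> b h" if "h \<in> H" for z h
    using ab[OF that] by blast
  have "tangent_cone x S = (\<Inter>h\<in>{h\<in>H. a h \<bullet> x = b h}. {z. a h \<bullet> z \<le> 0})"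
  proof (intro equalityI subsetI)
    fix y assume "y \<in> tangent_cone x S"
    then obtain e where "0 < e" "x + e *\<^sub>R y \<in> S"
      by (auto simp: tangent_cone_def)
    then have "e * (a h \<bullet> y) \<le> 0" if "h \<in> H" "a h \<bullet> x = b h" for h
      using that H(2) mem[of h "x + e *\<^sub>R y"] by (auto simp: inner_simps)
    then show "y \<in> (\<Inter>h\<in>{h\<in>H. a h \<bullet> x = b h}. {z. a h \<bullet> z \<le> 0})"
      using \<open>0 < e\<close> by (auto simp: mult_le_0_iff)
  next
    fix y assume y: "y \<in> (\<Inter>h\<in>{h\<in>H. a h \<bullet> x = b h}. {z. a h \<bullet> z \<le> 0})"
    have "\<forall>\<^sub>F e in at_right 0. x + e *\<^sub>R y \<in> h" if "h \<in> H" for h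
    proof (cases "a h \<bullet> x = b h")
      case True
      then have "a h \<bullet> y \<le> 0"
        using y that by blast
      then have "x + e *\<^sub>R y \<in> h" if "0 < e" for e
        using True that mem[OF \<open>h \<in> H\<close>] by (simp add: inner_simps mult_le_0_iff)
      then show ?thesis
        using eventually_at_right_less[of "0::real"] by (auto elim: eventually_mono)
    next
      case False
      then have "a h \<bullet> x < b h"
        using assms(2) H(2) mem[OF that, of x] that by auto
      moreover have "((\<lambda>e. a h \<bullet> (x + e *\<^sub>R y)) \<longlongrightarrow> a h \<bullet> (x + 0 *\<^sub>R y)) (at_right 0)"
        by (intro tendsto_intros)
      ultimately have "\<forall>\<^sub>F e in at_right 0. a h \<bullet> (x + e *\<^sub>R y) < b h"
        by (intro order_tendstoD(2)) auto
      then show ?thesis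
        by (rule eventually_mono) (use mem[OF that] in auto)
    qed
    then have "\<forall>\<^sub>F e in at_right 0. \<forall>h\<in>H. x + e *\<^sub>R y \<in> h"
      using H(1) by (simp add: eventually_ball_finite)
    then have "\<forall>\<^sub>F e in at_right (0::real). (\<forall>h\<in>H. x + e *\<^sub>R y \<in> h) \<and> 0 < e"
      using eventually_at_right_less[of "0::real"] by (rule eventually_conj)
    from eventually_happens'[OF trivial_limit_at_right_real this]
    obtain e :: real where "\<forall>h\<in>H. x + e *\<^sub>R y \<in> h" "0 < e"
      by blast
    then have "0 < e" "x + e *\<^sub>R y \<in> S"
      using H(2) by simp_all
    then show "y \<in> tangent_cone x S"
      by (rule tangent_coneI)
  qed
  then show ?thesis
    using H(1) by (auto intro!: polyhedron_Inter polyhedron_halfspace_le)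
qed

section \<open>Slices of a convex set\<close>

lemma slice_mono: "S \<subseteq> T \<Longrightarrow> slice x w S \<subseteq> slice x w T"
  unfolding slice_def using tangent_cone_mono by blast

lemma convex_slice: "\<lbrakk>convex S; x \<in> S\<rbrakk> \<Longrightarrow> convex (slice x w S)"
  unfolding slice_def by (intro convex_Int convex_tangent_cone convex_hyperplane)

lemma slice_direction:
  assumes "z \<in> S" "0 < w \<bullet> (z - x)"
  shows "(1 / (w \<bullet> (z - x))) *\<^sub>R (z - x) \<in> slice x w S"
  unfolding slice_def using assms by (auto intro!: tangent_coneI[of "w \<bullet> (z - x)"])

lemma slice_nonempty_iff: "slice x w S \<noteq> {} \<longleftrightarrow> (\<exists>z\<in>S. 0 < w \<bullet> (z - x))"
proof
  assume "slice x w S \<noteq> {}"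
  then obtain y e where "w \<bullet> y = 1" "0 < e" "x + e *\<^sub>R y \<in> S"
    by (auto simp: slice_def tangent_cone_def)
  then show "\<exists>z\<in>S. 0 < w \<bullet> (z - x)"
    by (intro bexI[of _ "x + e *\<^sub>R y"]) auto
qed (use slice_direction in blast)

text \<open>A short move from \<open>z\<close> towards \<open>p\<close> enters the relative interior
  and does not leave the open half-space. The segment is recorded so that \<open>q\<close> stays in
  every convex set containing \<open>z\<close> and \<open>p\<close>.\<close>

lemma rel_interior_point_on_side:
  fixes S :: "'a::euclidean_space set"
  assumes "convex S" "p \<in> rel_interior S" "z \<in> S" "0 < w \<bullet> (z - x)"
  obtains q where "q \<in> rel_interior S" "q \<in> closed_segment z p" "0 < w \<bullet> (q - x)"
proof -
  have "((\<lambda>s. w \<bullet> (z - s *\<^sub>R (z - p) - x)) \<longlongrightarrow> w \<bullet> (z - 0 *\<^sub>R (z - p) - x)) (at_right 0)"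
    by (intro tendsto_intros)
  then have "\<forall>\<^sub>F s in at_right 0. 0 < w \<bullet> (z - s *\<^sub>R (z - p) - x)"
    using assms(4) by (intro order_tendstoD(1)) auto
  moreover have "\<forall>\<^sub>F s in at_right (0::real). 0 < s \<and> s < 1"
    by (simp add: eventually_at_right_field) (metis zero_less_one)
  ultimately have "\<forall>\<^sub>F s in at_right (0::real). 0 < w \<bullet> (z - s *\<^sub>R (z - p) - x) \<and> 0 < s \<and> s < 1"
    by (rule eventually_conj)
  from eventually_happens'[OF trivial_limit_at_right_real this]
  obtain s :: real where s: "0 < w \<bullet> (z - s *\<^sub>R (z - p) - x)" "0 < s" "s < 1"
    by blast
  have "z - s *\<^sub>R (z - p) \<in> closed_segment z p"
    using s by (auto simp: in_segment algebra_simps intro!: exI[of _ s])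
  then show ?thesis
    using that rel_interior_convex_shrink[OF assms(1-3), of s] s by auto
qed

text \<open>Relative interior points are those beyond which segments can be prolonged. Shrinking two
  steps from \<open>x\<close> to the same length turns prolongations in the slice into prolongations
  in \<open>S\<close> and back. Through this equality the carriers of a complex determine those of
  its slices.\<close>

lemma rel_interior_slice:
  assumes "convex S" "x \<in> S" "slice x w S \<noteq> {}"
  shows "rel_interior (slice x w S) = slice x w (rel_interior S)"
proof (intro equalityI subsetI)
  note iff = convex_rel_interior_iff[OF convex_slice[OF assms(1,2)] assms(3)]
  fix y assume y: "y \<in> rel_interior (slice x w S)"
  obtain p where p: "p \<in> rel_interior S"
    using assms(1,2) rel_interior_eq_empty by blast
  obtain z where z: "z \<in> S" "0 < w \<bullet> (z - x)"
    using assms(3) slice_nonempty_iff by blast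
  obtain q where q: "q \<in> rel_interior S" "0 < w \<bullet> (q - x)"
    using rel_interior_point_on_side[OF assms(1) p z] by blast
  have "slice x w (rel_interior S) \<noteq> {}"
    using q slice_nonempty_iff by blast
  then obtain u where u: "u \<in> slice x w (rel_interior S)"
    by blast
  moreover have "slice x w (rel_interior S) \<subseteq> slice x w S"
    by (simp add: slice_mono rel_interior_subset)
  ultimately obtain e where e: "1 < e" and v: "(1 - e) *\<^sub>R u + e *\<^sub>R y \<in> slice x w S" (is "?v \<in> _")
    using y iff[of y] by blast
  obtain a b where ab: "0 < a" "x + a *\<^sub>R u \<in> rel_interior S" "0 < b" "x + b *\<^sub>R ?v \<in> S"
    using u v by (auto simp: slice_def tangent_cone_def)
  let ?d = "min a b"
  have d: "x + ?d *\<^sub>R u \<in> rel_interior S" "x + ?d *\<^sub>R ?v \<in> S"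
    using ab assms(1,2) by (auto intro: segment_in_convex segment_in_rel_interior)
  \<comment> \<open>The factor \<open>1 - 1/e\<close> undoes the prolongation: \<open>y\<close>
    divides the segment from \<open>?v\<close> to \<open>u\<close> in this ratio, and the end given
    by \<open>u\<close> is in the relative interior.\<close>
  have "x + ?d *\<^sub>R ?v - (1 - 1/e) *\<^sub>R (x + ?d *\<^sub>R ?v - (x + ?d *\<^sub>R u)) \<in> rel_interior S"
    using e by (intro rel_interior_convex_shrink[OF assms(1) d]) auto
  also have "x + ?d *\<^sub>R ?v - (1 - 1/e) *\<^sub>R (x + ?d *\<^sub>R ?v - (x + ?d *\<^sub>R u)) =
    x + ?d *\<^sub>R ((1/e) *\<^sub>R ?v + (1 - 1/e) *\<^sub>R u)"
  proof -
    have "x + d *\<^sub>R v - (1 - k) *\<^sub>R (x + d *\<^sub>R v - (x + d *\<^sub>R u)) =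
        x + d *\<^sub>R (k *\<^sub>R v + (1 - k) *\<^sub>R u)" for d k :: real and v
      by (simp add: algebra_simps)
    then show ?thesis .
  qed
  also have "(1/e) *\<^sub>R ?v + (1 - 1/e) *\<^sub>R u = y"
    using e by (simp add: scaleR_add_right scaleR_diff_right scaleR_diff_left)
  finally show "y \<in> slice x w (rel_interior S)"
    using ab y rel_interior_subset[of "slice x w S"] tangent_coneI[of ?d x y "rel_interior S"]
    by (auto simp: slice_def)
next
  note iff = convex_rel_interior_iff[OF convex_slice[OF assms(1,2)] assms(3)]
  fix y assume "y \<in> slice x w (rel_interior S)"
  then obtain e where e: "w \<bullet> y = 1" "0 < e" "x + e *\<^sub>R y \<in> rel_interior S"
    by (auto simp: slice_def tangent_cone_def)
  have "\<exists>c>1. (1 - c) *\<^sub>R v + c *\<^sub>R y \<in> slice x w S" if v: "v \<in> slice x w S" for v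
  proof -
    obtain b where b: "w \<bullet> v = 1" "0 < b" "x + b *\<^sub>R v \<in> S"
      using v by (auto simp: slice_def tangent_cone_def)
    let ?d = "min b e"
    have d: "x + ?d *\<^sub>R y \<in> rel_interior S" "x + ?d *\<^sub>R v \<in> S"
      using b e assms(1,2) by (auto intro: segment_in_convex segment_in_rel_interior)
    then obtain c where c: "1 < c" "(1 - c) *\<^sub>R (x + ?d *\<^sub>R v) + c *\<^sub>R (x + ?d *\<^sub>R y) \<in> S"
      using convex_rel_interior_iff[of S] assms(1,2) by blast
    moreover have "(1 - c) *\<^sub>R (x + ?d *\<^sub>R v) + c *\<^sub>R (x + ?d *\<^sub>R y) = x + ?d *\<^sub>R ((1 - c) *\<^sub>R v + c *\<^sub>R y)"
      by (simp add: algebra_simps)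
    ultimately show ?thesis
      using b e tangent_coneI[of ?d x "(1 - c) *\<^sub>R v + c *\<^sub>R y" S]
      by (intro exI[of _ c]) (auto simp: slice_def inner_simps)
  qed
  then show "y \<in> rel_interior (slice x w S)"
    using iff by blast
qed

text \<open>Membership in \<open>F\<close> and in the relative interior of \<open>R\<close> both
  persist when a step from \<open>x\<close> is shortened. For the converse a common point
  \<open>p\<close> may lie on the wrong side of the hyperplane; it is replaced by a point of the
  segment from \<open>z\<close> to \<open>p\<close> close to \<open>z\<close>.\<close>

lemma meets_rel_interior_slice_iff:
  assumes "convex R" "x \<in> R" "convex F" "F \<subseteq> R" "x \<in> F" "slice x w F \<noteq> {}"
  shows "slice x w F \<inter> rel_interior (slice x w R) \<noteq> {} \<longleftrightarrow> F \<inter> rel_interior R \<noteq> {}"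
proof -
  have "slice x w R \<noteq> {}"
    using assms(6) slice_mono[OF assms(4)] by blast
  note rel = rel_interior_slice[OF assms(1,2) this]
  show ?thesis
  proof
    assume "slice x w F \<inter> rel_interior (slice x w R) \<noteq> {}"
    then obtain y a b where "0 < a" "x + a *\<^sub>R y \<in> F" "0 < b" "x + b *\<^sub>R y \<in> rel_interior R"
      unfolding rel by (auto simp: slice_def tangent_cone_def)
    then have "x + min a b *\<^sub>R y \<in> F \<inter> rel_interior R"
      using assms by (auto intro: segment_in_convex segment_in_rel_interior)
    then show "F \<inter> rel_interior R \<noteq> {}"
      by blast
  next
    assume "F \<inter> rel_interior R \<noteq> {}"
    then obtain p where p: "p \<in> F" "p \<in> rel_interior R"
      by blast
    obtain z where z: "z \<in> F" "0 < w \<bullet> (z - x)"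
      using assms(6) slice_nonempty_iff by blast
    have "z \<in> R"
      using z assms(4) by blast
    then obtain q where q: "q \<in> rel_interior R" "q \<in> closed_segment z p" "0 < w \<bullet> (q - x)"
      using rel_interior_point_on_side[OF assms(1) p(2) _ z(2)] by blast
    then have "q \<in> F"
      using z(1) p(1) assms(3) by (meson closed_segment_subset subsetD)
    then show "slice x w F \<inter> rel_interior (slice x w R) \<noteq> {}"
      unfolding rel using slice_direction[of q _ w x] q by blast
  qed
qed

section \<open>Slices of a complex\<close>

lemma open_link_subset: "open_link x w M \<subseteq> M"
  by (auto simp: open_link_def)

lemma open_linkD:
  assumes "F \<in> open_link x w M"
  shows "F \<in> M" "x \<in> F" "slice x w F \<noteq> {}"
  using assms unfolding slice_nonempty_iff by (auto simp: open_link_def)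

text \<open>A direction in the relative interior of the slice of \<open>F\<close> leads, for short
  steps, to points of the relative interior of \<open>F\<close> lying in \<open>G\<close>, which
  forces \<open>F\<close> into \<open>G\<close>. Slicing is thus an order isomorphism on the open
  link.\<close>

lemma slice_subset_iff:
  assumes "cell_complex M" "F \<in> open_link x w M" "G \<in> open_link x w M"
  shows "slice x w F \<subseteq> slice x w G \<longleftrightarrow> F \<subseteq> G"
proof
  note F = open_linkD[OF assms(2)] and G = open_linkD[OF assms(3)]
  have cv: "convex F" "convex G"
    using F G cell_complexD(3)[OF assms(1)] by auto
  assume le: "slice x w F \<subseteq> slice x w G"
  obtain y where "y \<in> rel_interior (slice x w F)"
    using convex_slice[OF cv(1) F(2)] F(3) rel_interior_eq_empty by blast
  then have "y \<in> slice x w (rel_interior F)" "y \<in> slice x w G"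
    using rel_interior_slice[OF cv(1) F(2,3)] le rel_interior_subset by blast+
  then obtain a b where "0 < a" "x + a *\<^sub>R y \<in> rel_interior F" "0 < b" "x + b *\<^sub>R y \<in> G"
    by (auto simp: slice_def tangent_cone_def)
  then have "x + min a b *\<^sub>R y \<in> rel_interior F" "x + min a b *\<^sub>R y \<in> G"
    using F G cv by (auto intro: segment_in_convex segment_in_rel_interior)
  then show "F \<subseteq> G"
    using cell_complexD(6)[OF assms(1) F(1) G(1)] by blast
qed (rule slice_mono)

lemma cell_complex_slice:
  assumes M: "cell_complex M"
  shows "cell_complex (slice x w ` open_link x w M)"
  unfolding cell_complex_def ball_simps
proof (intro conjI ballI impI)
  show "finite (slice x w ` open_link x w M)"
    using finite_subset[OF open_link_subset cell_complexD(1)[OF M]] by simp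
next
  fix F assume F: "F \<in> open_link x w M"
  then show "polyhedron (slice x w F)"
    unfolding slice_def
    using open_linkD(1,2)[OF F] cell_complexD(2)[OF M] polyhedron_tangent_cone polyhedron_hyperplane
    by (intro polyhedron_Int) auto
  show "slice x w F \<noteq> {}"
    using open_linkD[OF F] by simp
next
  fix F G assume F: "F \<in> open_link x w M" and G: "G \<in> open_link x w M"
    and "rel_interior (slice x w F) \<inter> slice x w G \<noteq> {}"
  note F = open_linkD[OF F] and G = open_linkD[OF G]
  have cv: "convex F" "convex G"
    using F G cell_complexD(3)[OF M] by auto
  obtain y where "y \<in> slice x w (rel_interior F)" "y \<in> slice x w G"
    using rel_interior_slice[OF cv(1) F(2,3)] \<open>rel_interior (slice x w F) \<inter> slice x w G \<noteq> {}\<close> by blast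
  then obtain a b where "0 < a" "x + a *\<^sub>R y \<in> rel_interior F" "0 < b" "x + b *\<^sub>R y \<in> G"
    by (auto simp: slice_def tangent_cone_def)
  then have "x + min a b *\<^sub>R y \<in> rel_interior F" "x + min a b *\<^sub>R y \<in> G"
    using F G cv by (auto intro: segment_in_convex segment_in_rel_interior)
  then show "slice x w F \<subseteq> slice x w G"
    by (intro slice_mono cell_complexD(6)[OF M F(1) G(1)])
next
  fix G y assume G: "G \<in> open_link x w M" and y: "y \<in> slice x w G"
  note G = open_linkD[OF G]
  obtain d where d: "0 < d" "x + d *\<^sub>R y \<in> G" and wy: "w \<bullet> y = 1"
    using y by (auto simp: slice_def tangent_cone_def)
  have "x + s *\<^sub>R y \<in> \<Union>M" if "0 < s" "s \<le> d" for s
    using segment_in_convex[OF cell_complexD(3)[OF M G(1)] G(2) d(2) that] G(1) by blast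
  then obtain F s where F: "F \<in> M" "x \<in> F" "0 < s" "x + s *\<^sub>R y \<in> rel_interior F"
    using germ_in_cell[OF M d(1)] by metis
  have "x + s *\<^sub>R y \<in> F"
    using F rel_interior_subset by blast
  then have link: "F \<in> open_link x w M"
    unfolding open_link_def using F wy by (auto intro!: bexI[of _ "x + s *\<^sub>R y"])
  moreover have "y \<in> slice x w (rel_interior F)"
    using F wy by (auto simp: slice_def intro: tangent_coneI)
  ultimately show "\<exists>F\<in>slice x w ` open_link x w M. y \<in> rel_interior F"
    using rel_interior_slice[OF cell_complexD(3)[OF M F(1)] F(2) open_linkD(3)[OF link]] by blast
qed

text \<open>Convexity of the union keeps an initial piece of the ray inside, so one cell through
  \<open>x\<close> accounts for the direction. Slices therefore inherit a convex union.\<close>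

lemma Union_slice:
  assumes "cell_complex M" "convex (\<Union>M)" "x \<in> \<Union>M"
  shows "\<Union>(slice x w ` open_link x w M) = slice x w (\<Union>M)"
proof (intro equalityI subsetI)
  fix y assume "y \<in> \<Union>(slice x w ` open_link x w M)"
  then obtain F where "F \<in> M" "y \<in> slice x w F"
    using open_link_subset by blast
  then show "y \<in> slice x w (\<Union>M)"
    using slice_mono[of F "\<Union>M"] by blast
next
  fix y assume "y \<in> slice x w (\<Union>M)"
  then obtain d where d: "0 < d" "x + d *\<^sub>R y \<in> \<Union>M" and wy: "w \<bullet> y = 1"
    by (auto simp: slice_def tangent_cone_def)
  have "x + s *\<^sub>R y \<in> \<Union>M" if "0 < s" "s \<le> d" for s
    by (rule segment_in_convex[OF assms(2,3) d(2) that])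
  then obtain F s where F: "F \<in> M" "x \<in> F" "0 < s" "x + s *\<^sub>R y \<in> rel_interior F"
    using germ_in_cell[OF assms(1) d(1)] by metis
  have "x + s *\<^sub>R y \<in> F"
    using F rel_interior_subset by blast
  then have "F \<in> open_link x w M"
    unfolding open_link_def using F wy by (auto intro!: bexI[of _ "x + s *\<^sub>R y"])
  moreover have "y \<in> slice x w F"
    using \<open>x + s *\<^sub>R y \<in> F\<close> F(3) wy by (auto simp: slice_def intro: tangent_coneI)
  ultimately show "y \<in> \<Union>(slice x w ` open_link x w M)"
    by blast
qed

lemma open_link_nonempty:
  assumes "cell_complex M" "convex (\<Union>M)" "x \<in> \<Union>M" "z \<in> \<Union>M" "0 < w \<bullet> (z - x)"
  shows "open_link x w M \<noteq> {}"
  using slice_direction[OF assms(4,5)] Union_slice[OF assms(1-3), of w] by blast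

text \<open>It is a finite union of polyhedral tangent cones. Closedness serves to separate a point
  strictly from the cone.\<close>

lemma closed_tangent_cone_Union:
  assumes "cell_complex M" "convex (\<Union>M)" "x \<in> \<Union>M"
  shows "closed (tangent_cone x (\<Union>M))"
proof -
  have "tangent_cone x (\<Union>M) = (\<Union>F\<in>{F\<in>M. x \<in> F}. tangent_cone x F)"
  proof (intro equalityI subsetI)
    fix y assume "y \<in> tangent_cone x (\<Union>M)"
    then obtain d where d: "0 < d" "x + d *\<^sub>R y \<in> \<Union>M"
      by (auto simp: tangent_cone_def)
    have "x + s *\<^sub>R y \<in> \<Union>M" if "0 < s" "s \<le> d" for s
      by (rule segment_in_convex[OF assms(2,3) d(2) that])
    then obtain F s where F: "F \<in> M" "x \<in> F" "0 < s" "x + s *\<^sub>R y \<in> rel_interior F"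
      using germ_in_cell[OF assms(1) d(1)] by metis
    then have "y \<in> tangent_cone x F"
      using rel_interior_subset[of F] tangent_coneI[OF F(3), of x y F] by blast
    then show "y \<in> (\<Union>F\<in>{F\<in>M. x \<in> F}. tangent_cone x F)"
      using F by blast
  next
    fix y assume "y \<in> (\<Union>F\<in>{F\<in>M. x \<in> F}. tangent_cone x F)"
    then obtain F where "F \<in> M" "y \<in> tangent_cone x F"
      by blast
    then show "y \<in> tangent_cone x (\<Union>M)"
      using tangent_cone_mono[of F "\<Union>M"] by blast
  qed
  moreover have "closed (tangent_cone x F)" if "F \<in> M" "x \<in> F" for F
    by (rule polyhedron_imp_closed[OF polyhedron_tangent_cone[OF cell_complexD(2)[OF assms(1) that(1)] that(2)]])
  ultimately show ?thesis
    using cell_complexD(1)[OF assms(1)] by (simp add: closed_UN)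
qed

section \<open>Sweeping by distance from a centre\<close>

lemma insert_in_chains_of:
  assumes "G \<in> M" "b \<in> chains_of M" "\<And>F. F \<in> b \<Longrightarrow> G \<subseteq> F"
  shows "insert G b \<in> chains_of M"
proof (rule chains_ofI)
  show "insert G b \<subseteq> M"
    using assms chains_ofD(1) by fast
  show "F \<subseteq> F' \<or> F' \<subseteq> F" if "F \<in> insert G b" "F' \<in> insert G b" for F F'
    using that assms(3) chains_ofD(2)[OF assms(2), of F F'] by blast
qed

lemma chains_of_mono: "\<lbrakk>c \<in> chains_of M; M \<subseteq> N\<rbrakk> \<Longrightarrow> c \<in> chains_of N"
  by (auto simp: chains_of_def)

lemma inner_pos_if_dist_less:
  assumes "dist c y < dist c x"
  shows "0 < (c - x) \<bullet> (y - x)"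
proof -
  have "(c - y) \<bullet> (c - y) < (c - x) \<bullet> (c - x)"
    using assms by (simp add: dist_norm norm_lt)
  then have "(y - x) \<bullet> (y - x) < 2 * ((c - x) \<bullet> (y - x))"
    by (simp add: inner_simps inner_commute)
  then show ?thesis
    using inner_ge_zero[of "y - x"] by linarith
qed

text \<open>The abstract sweep with actual distances; its link becomes an open link because a cell
  through \<open>x\<close> comes nearer to \<open>c\<close> than \<open>x\<close> exactly if it
  enters the half-space of direction \<open>c - x\<close>. \<open>upper\<close> keeps the links
  inside \<open>N\<close>, and \<open>carrier\<close> does so for the carriers of closest
  points.\<close>

lemma collapses_away_by_distance:
  fixes M :: "'a::euclidean_space set set"
  assumes M: "cell_complex M" and "N \<subseteq> M"
    and upper: "\<And>F G. \<lbrakk>F \<in> N; G \<in> M; F \<subseteq> G\<rbrakk> \<Longrightarrow> G \<in> N"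
    and carrier: "\<And>F G. \<lbrakk>F \<in> N; G \<in> M; closest_point F c \<in> rel_interior G\<rbrakk> \<Longrightarrow> G \<in> N"
    and J: "J \<subseteq> chains_of N - {{}}"
    and up: "\<And>b G. \<lbrakk>b \<in> J; insert G b \<in> chains_of N\<rbrakk> \<Longrightarrow> insert G b \<in> J"
    and down: "\<And>b F G. \<lbrakk>b \<in> J; F \<in> b; G \<in> M; F \<noteq> G; G \<subseteq> F; closest_point F c \<in> rel_interior G\<rbrakk>
      \<Longrightarrow> b - {G} \<in> J"
    and link: "\<And>G x. \<lbrakk>G \<in> N; x = closest_point G c; x \<in> rel_interior G;
        \<And>F. F \<in> open_link x (c - x) M \<Longrightarrow> F \<in> N \<and> G \<subset> F\<rbrakk>
      \<Longrightarrow> collapses_away {b \<in> chains_of (open_link x (c - x) M). insert G b \<in> J}"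
  shows "collapses_away J"
proof -
  have cell: "closed F" "convex F" "F \<noteq> {}" if "F \<in> N" for F
    using cell_complexD(3-5)[OF M] \<open>N \<subseteq> M\<close> that by auto
  have x_in: "closest_point F c \<in> F" if "F \<in> N" for F
    using closest_point_in_set[OF cell(1,3)[OF that]] .
  have unique: "closest_point F c = closest_point G c"
    if "F \<in> N" "G \<in> N" "closest_point F c \<in> G" "dist c (closest_point F c) \<le> dist c (closest_point G c)" for F G
    by (rule closest_point_unique[OF cell(2,1)[OF that(2)] that(3)])
      (use closest_point_le[OF cell(1)[OF that(2)]] that(4) order_trans in blast)
  have mono: "dist c (closest_point G c) \<le> dist c (closest_point F c)"
    if "F \<in> N" "G \<in> N" "F \<subseteq> G" for F G
    using closest_point_le[OF cell(1)[OF that(2)]] x_in[OF that(1)] that(3) by blast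
  have "\<exists>G\<in>M. closest_point F c \<in> rel_interior G" if "F \<in> N" for F
    using cell_complexD(7)[OF M] x_in that \<open>N \<subseteq> M\<close> by blast
  then obtain \<kappa> where \<kappa>: "\<kappa> F \<in> M" "closest_point F c \<in> rel_interior (\<kappa> F)" if "F \<in> N" for F
    by metis
  have \<kappa>N: "\<kappa> F \<in> N" and \<kappa>F: "\<kappa> F \<subseteq> F" if "F \<in> N" for F
    using carrier[OF that \<kappa>[OF that]] cell_complexD(6)[OF M \<kappa>(1)[OF that] _ \<kappa>(2)[OF that] x_in[OF that]]
      that \<open>N \<subseteq> M\<close> by auto
  have \<kappa>_eq: "\<kappa> F = G" if "F \<in> N" "G \<in> M" "closest_point F c \<in> rel_interior G" for F G
    using carrier_unique[OF M] \<kappa>[OF that(1)] that by blast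
  have x\<kappa>: "closest_point (\<kappa> F) c = closest_point F c" if "F \<in> N" for F
  proof -
    have "closest_point F c \<in> \<kappa> F"
      using \<kappa>(2)[OF that] rel_interior_subset by blast
    then show ?thesis
      using unique[of F "\<kappa> F"] mono[of "\<kappa> F" F] \<kappa>N[OF that] \<kappa>F[OF that] that by simp
  qed
  show ?thesis
  proof (rule collapses_away_sweep[where \<kappa> = \<kappa> and m = "\<lambda>F. dist c (closest_point F c)"])
    show "finite N"
      using cell_complexD(1)[OF M] \<open>N \<subseteq> M\<close> finite_subset by blast
    show "\<kappa> F \<in> N \<and> \<kappa> F \<subseteq> F \<and> dist c (closest_point (\<kappa> F) c) = dist c (closest_point F c) \<and> \<kappa> (\<kappa> F) = \<kappa> F"
      if "F \<in> N" for F
      using \<kappa>N[OF that] \<kappa>F[OF that] x\<kappa>[OF that] \<kappa>_eq[OF \<kappa>N[OF that] \<kappa>(1)[OF that]] \<kappa>(2)[OF that] by simp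
    show "\<kappa> F = \<kappa> G" if "F \<in> N" "G \<in> N" "F \<subseteq> G"
      "dist c (closest_point F c) = dist c (closest_point G c)" for F G
    proof -
      have "closest_point F c = closest_point G c"
        using unique[OF that(1,2)] x_in[OF that(1)] that(3,4) by auto
      then show ?thesis
        using \<kappa>_eq[OF that(1) \<kappa>(1)[OF that(2)]] \<kappa>(2)[OF that(2)] by simp
    qed
    show "b - {\<kappa> F} \<in> J" if "b \<in> J" "F \<in> b" "F \<noteq> \<kappa> F" for b F
    proof -
      have "F \<in> N"
        using that J chains_ofD(1) by blast
      then show ?thesis
        using down[OF that(1,2) \<kappa>(1) that(3) \<kappa>F \<kappa>(2)] by simp
    qed
  next
    fix G assume G: "G \<in> N" "\<kappa> G = G"
    define x where "x = closest_point G c"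
    have x: "x \<in> rel_interior G" "x \<in> G"
      using \<kappa>(2)[OF G(1)] G x_in[OF G(1)] by (simp_all add: x_def)
    have link_eq: "{F \<in> N. G \<subset> F \<and> dist c (closest_point F c) < dist c (closest_point G c)}
      = open_link x (c - x) M" (is "?L = _")
    proof (intro equalityI subsetI)
      fix F assume F: "F \<in> ?L"
      then have "0 < (c - x) \<bullet> (closest_point F c - x)"
        by (intro inner_pos_if_dist_less) (auto simp: x_def)
      then show "F \<in> open_link x (c - x) M"
        using F x \<open>N \<subseteq> M\<close> x_in[of F] by (auto simp: open_link_def)
    next
      fix F assume "F \<in> open_link x (c - x) M"
      then obtain y where F: "F \<in> M" "x \<in> F" and y: "y \<in> F" "0 < (c - x) \<bullet> (y - x)"
        by (auto simp: open_link_def)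
      have GF: "G \<subseteq> F"
        using cell_complexD(6)[OF M _ F(1) x(1) F(2)] G(1) \<open>N \<subseteq> M\<close> by blast
      then have FN: "F \<in> N"
        using upper G F by blast
      \<comment> \<open>Otherwise \<open>x\<close> is a closest point of \<open>F\<close>, and the
        obtuse angle inequality for closest points contradicts the choice of
        \<open>y\<close>.\<close>
      have less: "dist c (closest_point F c) < dist c x"
      proof (rule ccontr)
        assume "\<not> ?thesis"
        then have "\<forall>z\<in>F. dist c x \<le> dist c z"
          using closest_point_le[OF cell(1)[OF FN], of _ c] by (meson not_less order_trans)
        then show False
          using any_closest_point_dot[OF cell(2,1)[OF FN] F(2) y(1)] y(2) by fastforce
      qed
      then have "G \<noteq> F"
        by (auto simp: x_def)
      then show "F \<in> ?L"
        using FN GF less by (auto simp: x_def)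
    qed
    show "collapses_away {b \<in> chains_of ?L. insert G b \<in> J}"
      unfolding link_eq
      by (rule link[OF G(1) x_def x(1)]) (use link_eq in auto)
  qed (use J up mono in auto)
qed

lemma collapses_away_chains_of_open_link:
  assumes "cell_complex M" "collapses_away (chains_of (slice x w ` open_link x w M))"
  shows "collapses_away (chains_of (open_link x w M))"
  using collapses_away_chains_image[where Q = "\<lambda>_. True", of "slice x w" "open_link x w M"]
    slice_subset_iff[OF assms(1)] assms(2) by simp

lemma card_slice_less:
  assumes M: "cell_complex M" and "G \<in> M" "\<And>F. F \<in> open_link x w M \<Longrightarrow> G \<subset> F"
  shows "card (slice x w ` open_link x w M) < card M"
proof -
  have "finite M"
    using cell_complexD(1)[OF M] .
  moreover have "open_link x w M \<subset> M"
    using assms open_link_subset by blast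
  ultimately show ?thesis
    using card_image_le[of "open_link x w M" "slice x w"] psubset_card_mono[of M "open_link x w M"]
      finite_subset[of "open_link x w M" M] by force
qed

text \<open>Any centre would do; it is \<open>0\<close>. \<open>G0\<close>, the carrier of the point
  of the union nearest to the centre, is kept for the final pair with the empty chain. At any other
  swept cell the nearest point \<open>x0\<close> lies in the open half-space, so the link is
  nonempty, and its slices form a smaller complex with convex union.\<close>

theorem collapses_away_convex:
  fixes M :: "'a::euclidean_space set set"
  assumes "cell_complex M" "convex (\<Union>M)" "M \<noteq> {}"
  shows "collapses_away (chains_of M)"
  using assms
proof (induction "card M" arbitrary: M rule: less_induct)
  case less
  note M = less.prems(1) and cvx = less.prems(2)
  let ?R = "\<Union>M"
  have R: "closed ?R" "?R \<noteq> {}"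
    using cell_complexD(1,4,5)[OF M] less.prems(3) by auto
  define x0 where "x0 = closest_point ?R 0"
  have x0: "x0 \<in> ?R" "\<And>z. z \<in> ?R \<Longrightarrow> dist 0 x0 \<le> dist 0 z"
    unfolding x0_def by (rule closest_point_in_set[OF R], rule closest_point_le[OF R(1)])
  then obtain G0 where G0: "G0 \<in> M" "x0 \<in> rel_interior G0"
    using cell_complexD(7)[OF M] by blast
  define J where "J = chains_of M - {{}, {G0}}"
  have ne: "closest_point F 0 \<in> F" if "F \<in> M" for F
    using closest_point_in_set cell_complexD(4,5)[OF M that] by blast
  have G0_only: "F = G0" if "F \<in> M" "closest_point F 0 \<in> rel_interior F" "x0 \<in> F" for F
  proof -
    have "x0 = closest_point F 0"
      using x0(2) that(1) by (intro closest_point_unique cell_complexD(3,4)[OF M that(1)] that(3)) auto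
    then show ?thesis
      using carrier_unique[OF M that(1) G0(1)] that(2) G0(2) by simp
  qed
  have "collapses_away J"
  proof (rule collapses_away_by_distance[OF M order_refl])
    show "J \<subseteq> chains_of M - {{}}"
      by (auto simp: J_def)
    show "insert G b \<in> J" if "b \<in> J" "insert G b \<in> chains_of M" for b G
      using that by (auto simp: J_def)
    show "b - {G} \<in> J" if b: "b \<in> J" "F \<in> b" and G: "G \<in> M" "F \<noteq> G" "G \<subseteq> F" and
      x: "closest_point F 0 \<in> rel_interior G" for b F G
    proof -
      have "F \<in> M"
        using b chains_ofD(1)[of b M] by (auto simp: J_def)
      have "F \<noteq> G0"
      proof
        assume "F = G0"
        moreover have "x0 = closest_point G0 0"
          using x0(2) G0 rel_interior_subset
          by (intro closest_point_unique cell_complexD(3,4)[OF M G0(1)]) auto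
        ultimately show False
          using carrier_unique[OF M G(1) G0(1)] x G0(2) G(2) by simp
      qed
      then show ?thesis
        using b G(2) chains_of_subset[of b M "b - {G}"] by (auto simp: J_def)
    qed
  next
    fix G x assume G: "G \<in> M" and x: "x = closest_point G 0" "x \<in> rel_interior G"
      and above: "\<And>F. F \<in> open_link x (0 - x) M \<Longrightarrow> F \<in> M \<and> G \<subset> F"
    let ?L = "open_link x (0 - x) M"
    have xR: "x \<in> ?R"
      using x(2) rel_interior_subset G by blast
    show "collapses_away {b \<in> chains_of ?L. insert G b \<in> J}"
    proof (cases "G = G0")
      case True
      then have "x = x0"
        using x0(2) G0 rel_interior_subset closest_point_unique[of G0 x0 0] cell_complexD(3,4)[OF M G0(1)] x(1)
        by auto
      then have "(0 - x) \<bullet> (y - x) \<le> 0" if "y \<in> ?R" for y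
        using closest_point_dot[OF cvx R(1) that, of 0] by (simp add: x0_def)
      then have "?L = {}"
        by (force simp: open_link_def)
      \<comment> \<open>The link is empty, so \<open>b\<close> can only be the empty chain, and
        \<open>{G0}\<close> was excluded from \<open>J\<close>.\<close>
      then have "{b \<in> chains_of ?L. insert G b \<in> J} = {}"
        using True by (auto simp: chains_of_def J_def)
      then show ?thesis
        by (simp only: collapses_away.empty)
    next
      case False
      have "x0 \<noteq> x"
        using G0_only[OF G] x False rel_interior_subset by auto
      then have "\<not> dist 0 x \<le> dist 0 x0"
        using x0(2) closest_point_unique[OF cvx R(1) xR, of 0] by (force simp: x0_def dest: order_trans)
      then have "0 < (0 - x) \<bullet> (x0 - x)"
        by (intro inner_pos_if_dist_less) simp
      then have nonempty: "?L \<noteq> {}"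
        using open_link_nonempty[OF M cvx xR x0(1)] by blast
      have "convex (\<Union>(slice x (0 - x) ` ?L))"
        using Union_slice[OF M cvx xR] convex_slice[OF cvx xR] by metis
      then have "collapses_away (chains_of (slice x (0 - x) ` ?L))"
        using nonempty card_slice_less[OF M G] above by (intro less.hyps cell_complex_slice M) auto
      then have "collapses_away (chains_of ?L)"
        by (rule collapses_away_chains_of_open_link[OF M])
      moreover have "{b \<in> chains_of ?L. insert G b \<in> J} = chains_of ?L"
      proof -
        have "insert G b \<in> chains_of M" if "b \<in> chains_of ?L" for b
          using above chains_ofD(1)[OF that] chains_of_mono[OF that open_link_subset]
          by (intro insert_in_chains_of G) auto
        then show ?thesis
          using False by (auto simp: J_def)
      qed
      ultimately show ?thesis
        by (simp only:)
    qed
  qed auto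
  moreover have "collapses_away {{}, {G0}}"
    by (rule collapses_away.step[of "{}" _ "{G0}"]) (auto intro: collapses_away.empty)
  ultimately have "collapses_away (J \<union> {{}, {G0}})"
    by (rule collapses_away_Un) (auto simp: J_def)
  moreover have "J \<union> {{}, {G0}} = chains_of M"
    using G0(1) by (auto simp: J_def chains_of_def)
  ultimately show ?case
    by simp
qed

section \<open>Collapsing onto the boundary\<close>

text \<open>The segment from \<open>p\<close> to \<open>x\<close> can be prolonged inside
  \<open>G\<close>, so \<open>x\<close> is a convex combination of two points of \<open>R\<close>
  with positive weight on the relative interior point \<open>p\<close>.\<close>

lemma rel_interior_if_face_meets:
  fixes R :: "'a::euclidean_space set"
  assumes "convex R" "convex G" "G \<subseteq> R" "x \<in> rel_interior G" "G \<inter> rel_interior R \<noteq> {}"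
  shows "x \<in> rel_interior R"
proof -
  obtain p where p: "p \<in> G" "p \<in> rel_interior R"
    using assms(5) by blast
  then obtain e where e: "1 < e" "(1 - e) *\<^sub>R p + e *\<^sub>R x \<in> G" (is "?q \<in> G")
    using convex_rel_interior_iff[OF assms(2), of x] assms(4) by blast
  have "?q - (1 - 1/e) *\<^sub>R (?q - p) \<in> rel_interior R"
    using e assms(3) by (intro rel_interior_convex_shrink assms(1) p(2)) auto
  also have "?q - (1 - 1/e) *\<^sub>R (?q - p) = (1 - 1/e) *\<^sub>R p + (1/e) *\<^sub>R ?q"
    by (simp add: algebra_simps)
  also have "\<dots> = x"
    using e by (simp add: scaleR_add_right scaleR_diff_left scaleR_diff_right)
  finally show ?thesis .
qed

lemma collapses_away_interior_chains:
  fixes M :: "'a::euclidean_space set set"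
  defines "R \<equiv> \<Union>M"
  assumes M: "cell_complex M" and cvx: "convex R" and "N \<subseteq> M"
    and upper: "\<And>F G. \<lbrakk>F \<in> N; G \<in> M; F \<subseteq> G\<rbrakk> \<Longrightarrow> G \<in> N"
    and carrier: "\<And>F G. \<lbrakk>F \<in> N; G \<in> M; closest_point F c \<in> rel_interior G\<rbrakk> \<Longrightarrow> G \<in> N"
    and away: "\<And>F. F \<in> N \<Longrightarrow> \<exists>y\<in>R. (c - closest_point F c) \<bullet> (y - closest_point F c) < 0"
    and boundary: "\<And>G x. \<lbrakk>G \<in> N; x = closest_point G c; x \<in> rel_interior G; x \<notin> rel_interior R;
        \<And>F. F \<in> open_link x (c - x) M \<Longrightarrow> G \<subset> F\<rbrakk>
      \<Longrightarrow> collapses_away {b \<in> chains_of (open_link x (c - x) M). \<exists>F\<in>b. F \<inter> rel_interior R \<noteq> {}}"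
  shows "collapses_away {b \<in> chains_of N. \<exists>F\<in>b. F \<inter> rel_interior R \<noteq> {}}" (is "collapses_away ?J")
proof (rule collapses_away_by_distance[OF M \<open>N \<subseteq> M\<close> upper carrier])
  show "b - {G} \<in> ?J" if b: "b \<in> ?J" "F \<in> b" and G: "F \<noteq> G" "G \<subseteq> F" for b F G
  proof -
    obtain F' where F': "F' \<in> b" "F' \<inter> rel_interior R \<noteq> {}"
      using b(1) by blast
    then have "\<exists>F\<in>b - {G}. F \<inter> rel_interior R \<noteq> {}"
      using b(2) G by (cases "F' = G") auto
    then show ?thesis
      using b(1) chains_of_subset[of b N "b - {G}"] by auto
  qed
next
  fix G x assume G: "G \<in> N" and x: "x = closest_point G c" "x \<in> rel_interior G"
    and above: "\<And>F. F \<in> open_link x (c - x) M \<Longrightarrow> F \<in> N \<and> G \<subset> F"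
  let ?L = "open_link x (c - x) M"
  have GM: "G \<in> M" and xG: "x \<in> G" and xR: "x \<in> R"
    using G \<open>N \<subseteq> M\<close> x(2) rel_interior_subset unfolding R_def by auto
  have ins: "insert G b \<in> chains_of N" if "b \<in> chains_of ?L" for b
  proof (rule insert_in_chains_of[OF G])
    show "b \<in> chains_of N"
      using above chains_of_mono[OF that, of N] by blast
    show "G \<subseteq> F" if "F \<in> b" for F
      using above[of F] that chains_ofD(1)[OF \<open>b \<in> chains_of ?L\<close>] by blast
  qed
  show "collapses_away {b \<in> chains_of ?L. insert G b \<in> ?J}"
  proof (cases "x \<in> rel_interior R")
    case True
    obtain y where y: "y \<in> R" "(c - x) \<bullet> (y - x) < 0"
      using away[OF G] x(1) by blast
    \<comment> \<open>Passing from \<open>y\<close> through \<open>x\<close> and a little beyond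
      reverses the sign of the inner product with \<open>c - x\<close>.\<close>
    obtain e where e: "1 < e" "(1 - e) *\<^sub>R y + e *\<^sub>R x \<in> R" (is "?z \<in> R")
      using True y(1) convex_rel_interior_iff[OF cvx, of x] by blast
    have "?z - x = (1 - e) *\<^sub>R (y - x)"
      by (simp add: algebra_simps)
    then have "0 < (c - x) \<bullet> (?z - x)"
      using e(1) y(2) by (simp add: zero_less_mult_iff)
    then have "?L \<noteq> {}"
      using open_link_nonempty[OF M, of x ?z] cvx xR e(2) unfolding R_def by blast
    moreover have "convex (\<Union>(slice x (c - x) ` ?L))"
      using Union_slice[OF M, of x] convex_slice[of R x] cvx xR unfolding R_def by simp
    ultimately have "collapses_away (chains_of (slice x (c - x) ` ?L))"
      by (intro collapses_away_convex cell_complex_slice M) auto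
    then have "collapses_away (chains_of ?L)"
      by (rule collapses_away_chains_of_open_link[OF M])
    moreover have "G \<inter> rel_interior R \<noteq> {}"
      using xG True by blast
    then have "insert G b \<in> ?J" if "b \<in> chains_of ?L" for b
      using ins[OF that] by simp
    then have "{b \<in> chains_of ?L. insert G b \<in> ?J} = chains_of ?L"
      by auto
    ultimately show ?thesis
      by (simp only:)
  next
    case False
    have "G \<inter> rel_interior R = {}"
      using rel_interior_if_face_meets[OF cvx cell_complexD(3)[OF M GM] _ x(2)] False GM
      unfolding R_def by blast
    then have "insert G b \<in> ?J \<longleftrightarrow> (\<exists>F\<in>b. F \<inter> rel_interior R \<noteq> {})" if "b \<in> chains_of ?L" for b
      using ins[OF that] by simp
    then have "{b \<in> chains_of ?L. insert G b \<in> ?J} = {b \<in> chains_of ?L. \<exists>F\<in>b. F \<inter> rel_interior R \<noteq> {}}"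
      by (intro Collect_cong conj_cong refl)
    moreover have "collapses_away {b \<in> chains_of ?L. \<exists>F\<in>b. F \<inter> rel_interior R \<noteq> {}}"
      by (rule boundary[OF G x False]) (simp add: above)
    ultimately show ?thesis
      by (simp only:)
  qed
qed auto

section \<open>Receding unions\<close>

text \<open>A one-step form of a direction of recession: iterating the translation drives the linear
  form to infinity on a nonempty set, while it stays bounded below.\<close>

definition recedes :: "'a::euclidean_space set \<Rightarrow> bool" where
  "recedes S \<longleftrightarrow> (\<exists>a \<beta> e. (\<forall>y\<in>S. \<beta> \<le> a \<bullet> y) \<and> (\<forall>y\<in>S. y + e \<in> S) \<and> 0 < a \<bullet> e)"

lemma not_rel_interior_direction:
  fixes S :: "'a::euclidean_space set"
  assumes "convex S" "x \<in> S" "x \<notin> rel_interior S"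
  obtains y where "y \<in> S" "\<And>s. 0 < s \<Longrightarrow> x - s *\<^sub>R (y - x) \<notin> S"
proof -
  obtain y where y: "y \<in> S" "\<And>e. 1 < e \<Longrightarrow> (1 - e) *\<^sub>R y + e *\<^sub>R x \<notin> S"
    using convex_rel_interior_iff[OF assms(1), of x] assms(2,3) by blast
  have "x - s *\<^sub>R (y - x) \<notin> S" if "0 < s" for s
  proof -
    have "x - s *\<^sub>R (y - x) = (1 - (1 + s)) *\<^sub>R y + (1 + s) *\<^sub>R x"
      by (simp add: algebra_simps)
    then show ?thesis
      using y(2)[of "1 + s"] that by simp
  qed
  then show thesis
    using that y(1) by blast
qed

text \<open>A relative boundary point has a tangent direction \<open>k\<close> that cannot be
  reversed. A nonnegative multiple of a tangent direction \<open>d\<close> from the other side moves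
  \<open>k\<close> into the hyperplane. If the sum could be reversed, adding that multiple of
  \<open>d\<close> to its negative would reverse \<open>k\<close>.\<close>

lemma tangent_direction_in_hyperplane:
  fixes R :: "'a::euclidean_space set"
  assumes "convex R" "x \<in> R" "x \<notin> rel_interior R"
    and "u \<in> R" "w \<bullet> (u - x) < 0" "v \<in> R" "0 < w \<bullet> (v - x)"
  obtains \<rho> where "\<rho> \<in> tangent_cone x R" "w \<bullet> \<rho> = 0" "- \<rho> \<notin> tangent_cone x R"
proof -
  let ?T = "tangent_cone x R"
  obtain y where y: "y \<in> R" "\<And>s. 0 < s \<Longrightarrow> x - s *\<^sub>R (y - x) \<notin> R"
    using not_rel_interior_direction[OF assms(1-3)] by blast
  define k where "k = y - x"
  have "x + s *\<^sub>R - k = x - s *\<^sub>R (y - x)" for s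
    by (simp add: k_def algebra_simps)
  then have k: "k \<in> ?T" "- k \<notin> ?T"
    using y(2) tangent_cone_diff[OF y(1), of x] unfolding tangent_cone_def by (auto simp: k_def)
  obtain d where d: "d \<in> ?T" "w \<bullet> d * (w \<bullet> k) < 0 \<or> w \<bullet> k = 0"
  proof (cases "0 < w \<bullet> k")
    case True
    then show ?thesis
      using that[OF tangent_cone_diff[OF assms(4), of x]] mult_neg_pos[OF assms(5)] by blast
  next
    case False
    then have "w \<bullet> k < 0 \<or> w \<bullet> k = 0"
      by linarith
    then show ?thesis
      using that[OF tangent_cone_diff[OF assms(6), of x]] mult_pos_neg[OF assms(7)] by blast
  qed
  define s where "s = - (w \<bullet> k) / (w \<bullet> d)"
  have s: "0 \<le> s" "w \<bullet> k + s * (w \<bullet> d) = 0"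
    using d(2) by (auto simp: s_def mult_less_0_iff divide_simps)
  have sd: "s *\<^sub>R d \<in> ?T"
    by (rule tangent_cone_scale[OF assms(2) d(1) s(1)])
  show thesis
  proof (rule that[of "k + s *\<^sub>R d"])
    show "k + s *\<^sub>R d \<in> ?T"
      by (rule tangent_cone_add[OF assms(1,2) k(1) sd])
    show "- (k + s *\<^sub>R d) \<notin> ?T"
      using tangent_cone_add[OF assms(1,2) _ sd, of "- (k + s *\<^sub>R d)"] k(2) by auto
  qed (use s in \<open>simp add: inner_simps\<close>)
qed

text \<open>Strict separation of \<open>- \<rho>\<close> from the closed cone yields a form that is
  nonnegative on the cone, by scaling, and positive on \<open>\<rho>\<close>. Translation by
  \<open>\<rho>\<close> preserves the slice since it does not change \<open>w\<close>.\<close>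

lemma recedes_slice:
  assumes M: "cell_complex M" "convex (\<Union>M)" "x \<in> \<Union>M"
    and \<rho>: "\<rho> \<in> tangent_cone x (\<Union>M)" "w \<bullet> \<rho> = 0" "- \<rho> \<notin> tangent_cone x (\<Union>M)"
  shows "recedes (slice x w (\<Union>M))"
proof -
  let ?T = "tangent_cone x (\<Union>M)"
  obtain a b where ab: "a \<bullet> (- \<rho>) < b" "\<And>k. k \<in> ?T \<Longrightarrow> b < a \<bullet> k"
    using separating_hyperplane_closed_point[OF convex_tangent_cone[OF M(2,3)] closed_tangent_cone_Union[OF M] \<rho>(3)]
    by blast
  have b: "b < 0"
    using ab(2)[OF tangent_cone_scale[OF M(3) \<rho>(1), of 0]] by simp
  have "0 \<le> a \<bullet> k" if "k \<in> ?T" for k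
  proof (rule ccontr)
    assume neg: "\<not> 0 \<le> a \<bullet> k"
    then have "b < a \<bullet> ((b / (a \<bullet> k)) *\<^sub>R k)"
      using b by (intro ab(2) tangent_cone_scale[OF M(3) that]) (auto simp: divide_nonpos_neg)
    then show False
      using neg by simp
  qed
  moreover have "y + \<rho> \<in> slice x w (\<Union>M)" if "y \<in> slice x w (\<Union>M)" for y
    using that tangent_cone_add[OF M(2,3) _ \<rho>(1)] \<rho>(2) by (auto simp: slice_def inner_simps)
  moreover have "0 < a \<bullet> \<rho>"
    using ab(1) b by simp
  ultimately show ?thesis
    unfolding recedes_def slice_def by blast
qed

text \<open>The comparison of squared distances with \<open>c \<bullet> c\<close> cancelled, so that
  the explicit dependence on a far centre \<open>c\<close> is only linear.\<close>

lemma closest_point_dist_sq: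
  fixes F :: "'a::euclidean_space set"
  assumes "closed F" "z \<in> F"
  shows "closest_point F c \<bullet> closest_point F c - 2 * (c \<bullet> closest_point F c) \<le> z \<bullet> z - 2 * (c \<bullet> z)"
proof -
  let ?x = "closest_point F c"
  have "norm (c - ?x) \<le> norm (c - z)"
    using closest_point_le[OF assms, of c] by (simp add: dist_norm)
  then have "(c - ?x) \<bullet> (c - ?x) \<le> (c - z) \<bullet> (c - z)"
    by (simp add: norm_le)
  then show ?thesis
    by (simp add: inner_simps inner_commute)
qed

text \<open>In an unbounded cell the closest points may escape as the centre
  \<open>- t *\<^sub>R a\<close> does. Comparison with a fixed \<open>z\<close> and the lower bound
  \<open>\<beta>\<close> give squared norm at most \<open>t * K\<close>, so they escape only like
  the square root of \<open>t\<close>, and the linear term \<open>t * (a \<bullet> e)\<close>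
  dominates.\<close>

lemma eventually_recedes_from_center:
  fixes F :: "'a::euclidean_space set"
  assumes "closed F" "F \<noteq> {}" "\<And>y. y \<in> F \<Longrightarrow> \<beta> \<le> a \<bullet> y" "0 < a \<bullet> e"
  shows "\<forall>\<^sub>F t in at_top. (- t *\<^sub>R a - closest_point F (- t *\<^sub>R a)) \<bullet> e < 0"
proof -
  obtain z where z: "z \<in> F"
    using assms(2) by blast
  define K where "K = z \<bullet> z + 2 * (a \<bullet> z - \<beta>)"
  have K: "0 \<le> K"
    using assms(3)[OF z] by (simp add: K_def)
  have "(- t *\<^sub>R a - closest_point F (- t *\<^sub>R a)) \<bullet> e < 0"
    if t: "1 \<le> t" "K * (e \<bullet> e) / (a \<bullet> e)\<^sup>2 < t" for t
  proof -
    let ?x = "closest_point F (- t *\<^sub>R a)"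
    have "\<beta> \<le> a \<bullet> ?x"
      using assms(3) closest_point_in_set[OF assms(1,2)] by blast
    then have "t * \<beta> \<le> t * (a \<bullet> ?x)"
      using t by simp
    then have "?x \<bullet> ?x \<le> z \<bullet> z + 2 * (t * (a \<bullet> z)) - 2 * (t * \<beta>)"
      using closest_point_dist_sq[OF assms(1) z, of "- t *\<^sub>R a"] by simp
    also have "\<dots> = z \<bullet> z + t * (2 * (a \<bullet> z - \<beta>))"
      by (simp add: algebra_simps)
    also have "\<dots> \<le> t * (z \<bullet> z) + t * (2 * (a \<bullet> z - \<beta>))"
      using mult_right_mono[OF t(1), of "z \<bullet> z"] by simp
    also have "\<dots> = t * K"
      by (simp add: K_def algebra_simps)
    finally have xK: "?x \<bullet> ?x \<le> t * K" .
    have "(?x \<bullet> e)\<^sup>2 \<le> (?x \<bullet> ?x) * (e \<bullet> e)"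
      by (rule Cauchy_Schwarz_ineq)
    also have "\<dots> \<le> t * K * (e \<bullet> e)"
      using xK by (rule mult_right_mono) simp
    also have "\<dots> < t * (t * (a \<bullet> e)\<^sup>2)"
      using t assms(4) by (simp add: divide_simps mult.assoc)
    also have "\<dots> = (t * (a \<bullet> e))\<^sup>2"
      by (simp add: power2_eq_square)
    finally have "\<not> \<bar>t * (a \<bullet> e)\<bar> \<le> \<bar>?x \<bullet> e\<bar>"
      by (simp add: abs_le_square_iff)
    moreover have "0 \<le> t * (a \<bullet> e)"
      using t assms(4) by simp
    ultimately show ?thesis
      by (simp add: inner_simps)
  qed
  then show ?thesis
    by (auto intro!: eventually_mono[OF eventually_conj[OF eventually_ge_at_top[of 1] eventually_gt_at_top]])
qed

lemma collapses_away_boundary_link: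
  assumes M: "cell_complex M" "convex (\<Union>M)" "x \<in> \<Union>M"
    and ca: "collapses_away {b \<in> chains_of (slice x w ` open_link x w M).
               \<exists>F\<in>b. F \<inter> rel_interior (\<Union>(slice x w ` open_link x w M)) \<noteq> {}}"
  shows "collapses_away {b \<in> chains_of (open_link x w M). \<exists>F\<in>b. F \<inter> rel_interior (\<Union>M) \<noteq> {}}"
proof -
  let ?L = "open_link x w M"
  have iff: "slice x w F \<inter> rel_interior (slice x w (\<Union>M)) \<noteq> {} \<longleftrightarrow> F \<inter> rel_interior (\<Union>M) \<noteq> {}"
    if "F \<in> ?L" for F
    using open_linkD[OF that] cell_complexD(3)[OF M(1)]
    by (intro meets_rel_interior_slice_iff M(2,3)) auto
  have "collapses_away {b \<in> chains_of ?L. \<exists>F\<in>slice x w ` b. F \<inter> rel_interior (slice x w (\<Union>M)) \<noteq> {}}"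
    by (rule collapses_away_chains_image[OF ca[unfolded Union_slice[OF M]]])
      (rule slice_subset_iff[OF M(1)])
  moreover have "{b \<in> chains_of ?L. \<exists>F\<in>slice x w ` b. F \<inter> rel_interior (slice x w (\<Union>M)) \<noteq> {}}
     = {b \<in> chains_of ?L. \<exists>F\<in>b. F \<inter> rel_interior (\<Union>M) \<noteq> {}}"
  proof (intro Collect_cong conj_cong refl)
    fix b assume b: "b \<in> chains_of ?L"
    have "F \<in> ?L" if "F \<in> b" for F
      using chains_ofD(1)[OF b] that by (rule subsetD)
    then show "(\<exists>F\<in>slice x w ` b. F \<inter> rel_interior (slice x w (\<Union>M)) \<noteq> {}) \<longleftrightarrow>
        (\<exists>F\<in>b. F \<inter> rel_interior (\<Union>M) \<noteq> {})"
      by (simp add: iff)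
  qed
  ultimately show ?thesis
    by (simp only:)
qed

lemma collapses_away_trivial_link:
  assumes "open_link x w M = {}"
  shows "collapses_away {b \<in> chains_of (open_link x w M). \<exists>F\<in>b. P F}"
proof -
  have "{b \<in> chains_of (open_link x w M). \<exists>F\<in>b. P F} = {}"
    by (auto simp: chains_of_def assms)
  then show ?thesis
    by (simp only: collapses_away.empty)
qed

text \<open>With the centre far out against \<open>a\<close>, the point \<open>x + e\<close> always
  lies on the side of \<open>x\<close> away from the centre. If the link at a boundary point is
  nonempty, the union thus has points on both sides of the hyperplane, its slice recedes again, and
  the induction closes.\<close>

theorem collapses_away_receding:
  fixes M :: "'a::euclidean_space set set"
  assumes "cell_complex M" "convex (\<Union>M)" "recedes (\<Union>M)"
  shows "collapses_away {b \<in> chains_of M. \<exists>F\<in>b. F \<inter> rel_interior (\<Union>M) \<noteq> {}}"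
  using assms
proof (induction "card M" arbitrary: M rule: less_induct)
  case less
  note M = less.prems(1) and cvx = less.prems(2)
  let ?R = "\<Union>M"
  obtain a \<beta> e where rec: "\<And>y. y \<in> ?R \<Longrightarrow> \<beta> \<le> a \<bullet> y" "\<And>y. y \<in> ?R \<Longrightarrow> y + e \<in> ?R" "0 < a \<bullet> e"
    using less.prems(3) unfolding recedes_def by blast
  have "\<forall>\<^sub>F t in at_top. (- t *\<^sub>R a - closest_point F (- t *\<^sub>R a)) \<bullet> e < 0" if "F \<in> M" for F
    using that rec(1,3) by (intro eventually_recedes_from_center[where \<beta> = \<beta>] cell_complexD(4,5)[OF M]) auto
  then have "\<forall>\<^sub>F t in at_top. \<forall>F\<in>M. (- t *\<^sub>R a - closest_point F (- t *\<^sub>R a)) \<bullet> e < 0"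
    using cell_complexD(1)[OF M] by (simp add: eventually_ball_finite)
  then obtain t where t: "\<And>F. F \<in> M \<Longrightarrow> (- t *\<^sub>R a - closest_point F (- t *\<^sub>R a)) \<bullet> e < 0"
    using eventually_happens'[OF trivial_limit_at_top_linorder] by blast
  define c where "c = - t *\<^sub>R a"
  have xR: "closest_point F c \<in> ?R" if "F \<in> M" for F
    using closest_point_in_set cell_complexD(4,5)[OF M that] that by blast
  show ?case
  proof (rule collapses_away_interior_chains[OF M cvx order_refl])
    show "\<exists>y\<in>?R. (c - closest_point F c) \<bullet> (y - closest_point F c) < 0" if "F \<in> M" for F
      using t[OF that] rec(2)[OF xR[OF that]] by (intro bexI[of _ "closest_point F c + e"]) (simp_all add: c_def)
  next
    fix G x assume G: "G \<in> M" and x: "x = closest_point G c" "x \<in> rel_interior G" "x \<notin> rel_interior ?R"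
      and above: "\<And>F. F \<in> open_link x (c - x) M \<Longrightarrow> G \<subset> F"
    let ?L = "open_link x (c - x) M"
    have xR: "x \<in> ?R"
      using xR[OF G] x(1) by simp
    show "collapses_away {b \<in> chains_of ?L. \<exists>F\<in>b. F \<inter> rel_interior ?R \<noteq> {}}"
    proof (cases "?L = {}")
      case False
      then obtain v where v: "v \<in> ?R" "0 < (c - x) \<bullet> (v - x)"
        by (auto simp: open_link_def)
      have "(c - x) \<bullet> (x + e - x) < 0"
        using t[OF G] by (simp add: c_def x(1))
      then obtain \<rho> where "\<rho> \<in> tangent_cone x ?R" "(c - x) \<bullet> \<rho> = 0" "- \<rho> \<notin> tangent_cone x ?R"
        using tangent_direction_in_hyperplane[OF cvx xR x(3) rec(2)[OF xR] _ v] by blast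
      then have "recedes (slice x (c - x) ?R)"
        by (rule recedes_slice[OF M cvx xR])
      then show ?thesis
        using Union_slice[OF M cvx xR, of "c - x"] convex_slice[OF cvx xR, of "c - x"] card_slice_less[OF M G above]
        by (intro collapses_away_boundary_link[OF M cvx xR] less.hyps cell_complex_slice M) simp_all
    qed (rule collapses_away_trivial_link)
  qed
qed

section \<open>Subdivisions of polytopal complexes\<close>

lemma polytopal_complexD:
  assumes "polytopal_complex C"
  shows "finite C"
    and "P \<in> C \<Longrightarrow> polytope P" "P \<in> C \<Longrightarrow> P \<noteq> {}" "P \<in> C \<Longrightarrow> convex P"
    and "\<lbrakk>P \<in> C; F face_of P; F \<noteq> {}\<rbrakk> \<Longrightarrow> F \<in> C"
    and "\<lbrakk>P \<in> C; Q \<in> C\<rbrakk> \<Longrightarrow> P \<inter> Q face_of Q"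
proof -
  note C = assms[unfolded polytopal_complex_def]
  show "finite C" "P \<in> C \<Longrightarrow> polytope P" "P \<in> C \<Longrightarrow> P \<noteq> {}"
    using C by blast+
  then show "P \<in> C \<Longrightarrow> convex P"
    using polytope_imp_convex by blast
  show "\<lbrakk>P \<in> C; F face_of P; F \<noteq> {}\<rbrakk> \<Longrightarrow> F \<in> C" "\<lbrakk>P \<in> C; Q \<in> C\<rbrakk> \<Longrightarrow> P \<inter> Q face_of Q"
    using C by blast+
qed

lemma polytopal_subcomplex:
  assumes C: "polytopal_complex C" and "C1 \<subseteq> C"
    and "\<And>P F. \<lbrakk>P \<in> C1; F \<in> C; F face_of P\<rbrakk> \<Longrightarrow> F \<in> C1"
  shows "polytopal_complex C1"
  unfolding polytopal_complex_def
proof (intro conjI ballI allI impI)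
  show "finite C1"
    using polytopal_complexD(1)[OF C] assms(2) finite_subset by blast
  show "polytope P" "P \<noteq> {}" if "P \<in> C1" for P
    using polytopal_complexD(2,3)[OF C] that assms(2) by blast+
  show "F \<in> C1" if "P \<in> C1" "F face_of P \<and> F \<noteq> {}" for P F
    using polytopal_complexD(5)[OF C, of P F] that assms(2,3) by blast
  show "P \<inter> Q face_of P" "P \<inter> Q face_of Q" if "P \<in> C1" "Q \<in> C1" for P Q
    using polytopal_complexD(6)[OF C, of P Q] polytopal_complexD(6)[OF C, of Q P] that assms(2)
    by (auto simp: Int_commute)
qed

lemma rel_interior_nonempty_cell:
  assumes "polytopal_complex C" "P \<in> C"
  obtains x where "x \<in> rel_interior P"
  using polytopal_complexD(3,4)[OF assms] rel_interior_eq_empty by blast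

lemma cell_subset_if_meets:
  assumes "polytopal_complex C" "P \<in> C" "Q \<in> C" "S \<subseteq> Q" "x \<in> rel_interior S" "x \<in> P"
  shows "S \<subseteq> P"
proof -
  have "x \<in> Q"
    using assms(4,5) rel_interior_subset by blast
  then have "S \<subseteq> P \<inter> Q"
    using subset_of_face_of[OF polytopal_complexD(6)[OF assms(1-3)] assms(4)] assms(5,6) by blast
  then show ?thesis
    by blast
qed

text \<open>A minimal cell containing \<open>x\<close> works: if \<open>x\<close> were on its
  relative frontier, a proper face through \<open>x\<close> would be a smaller cell.\<close>

lemma carrier_face:
  assumes "polytopal_complex C" "P \<in> C" "x \<in> P"
  obtains F where "F \<in> C" "x \<in> rel_interior F"
proof -
  have fin: "finite {F \<in> C. x \<in> F}"
    using polytopal_complexD(1)[OF assms(1)] by simp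
  then obtain F where F: "F \<in> C" "x \<in> F" and min: "\<And>G. \<lbrakk>G \<in> C; x \<in> G; G \<subseteq> F\<rbrakk> \<Longrightarrow> G = F"
    using finite_has_minimal[OF fin] assms(2,3) by blast
  have "x \<in> rel_interior F"
  proof (rule ccontr)
    assume "x \<notin> rel_interior F"
    then have "x \<in> rel_frontier F"
      using F(2) closure_subset by (auto simp: rel_frontier_def)
    moreover have "polyhedron F"
      using polytopal_complexD(2)[OF assms(1) F(1)] by (rule polytope_imp_polyhedron)
    ultimately obtain G where G: "G face_of F" "G \<noteq> F" "x \<in> G"
      unfolding rel_frontier_of_polyhedron_alt[OF \<open>polyhedron F\<close>] by blast
    then have "G \<in> C"
      using polytopal_complexD(5)[OF assms(1) F(1)] by blast
    then show False
      using min G face_of_imp_subset by blast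
  qed
  then show thesis
    using that F(1) by blast
qed

lemma cell_complex_restrict:
  assumes "polytopal_complex D"
  shows "cell_complex {F \<in> D. F \<subseteq> S}"
  unfolding cell_complex_def
proof (intro conjI ballI impI)
  fix F G assume F: "F \<in> {F \<in> D. F \<subseteq> S}" and G: "G \<in> {F \<in> D. F \<subseteq> S}"
    and "rel_interior F \<inter> G \<noteq> {}"
  then obtain x where "x \<in> rel_interior F" "x \<in> G"
    by blast
  then show "F \<subseteq> G"
    using F G by (intro cell_subset_if_meets[OF assms, of G F F x]) auto
next
  fix G x assume G: "G \<in> {F \<in> D. F \<subseteq> S}" and x: "x \<in> G"
  then obtain F where F: "F \<in> D" "x \<in> rel_interior F"
    using carrier_face[OF assms] by blast
  have "F \<subseteq> G"
    using F G x by (intro cell_subset_if_meets[OF assms, of G F F x]) auto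
  then show "\<exists>F\<in>{F \<in> D. F \<subseteq> S}. x \<in> rel_interior F"
    using F G by blast
qed (use polytopal_complexD[OF assms] in \<open>auto intro: polytope_imp_polyhedron\<close>)

lemma subdivision_cell_subset:
  assumes C: "polytopal_complex C" and D: "subdivision_of D C"
    and "F \<in> D" "H \<in> C" "x \<in> rel_interior F" "x \<in> H"
  shows "F \<subseteq> H"
proof -
  obtain G where "G \<in> C" "F \<subseteq> G"
    using D \<open>F \<in> D\<close> unfolding subdivision_of_def by blast
  then show ?thesis
    using cell_subset_if_meets[OF C \<open>H \<in> C\<close> _ _ assms(5,6)] by blast
qed

lemma Union_cells_in:
  assumes C: "polytopal_complex C" and D: "subdivision_of D C" and "H \<in> C"
  shows "\<Union>{F \<in> D. F \<subseteq> H} = H"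
proof (intro equalityI subsetI)
  fix x assume x: "x \<in> H"
  have poly: "polytopal_complex D" and eq: "\<Union>D = \<Union>C"
    using D unfolding subdivision_of_def underlying_def by auto
  obtain G where "G \<in> D" "x \<in> G"
    using x \<open>H \<in> C\<close> eq by blast
  then obtain F where F: "F \<in> D" "x \<in> rel_interior F"
    using carrier_face[OF poly] by blast
  have "F \<subseteq> H"
    by (rule subdivision_cell_subset[OF C D F(1) \<open>H \<in> C\<close> F(2) x])
  then show "x \<in> \<Union>{F \<in> D. F \<subseteq> H}"
    using F rel_interior_subset by blast
qed blast

lemma polytopal_complex_elementary_collapse:
  assumes "polytopal_complex C" "elementary_collapse C C1"
  shows "polytopal_complex C1"
proof -
  obtain \<sigma> where C1: "C1 = C - {G \<in> C. \<sigma> \<subseteq> G}"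
    using assms(2) unfolding elementary_collapse_def by blast
  show ?thesis
  proof (rule polytopal_subcomplex[OF assms(1)])
    show "F \<in> C1" if "P \<in> C1" "F \<in> C" "F face_of P" for P F
      using that(1,2) face_of_imp_subset[OF that(3)] unfolding C1 by blast
  qed (auto simp: C1)
qed

lemma subdivision_of_subcomplex:
  assumes C: "polytopal_complex C" and D: "subdivision_of D C"
    and C1: "polytopal_complex C1" "C1 \<subseteq> C"
  shows "subdivision_of {F \<in> D. F \<subseteq> \<Union>C1} C1"
proof -
  have poly: "polytopal_complex D"
    using D unfolding subdivision_of_def by blast
  let ?E = "{F \<in> D. F \<subseteq> \<Union>C1}"
  have "polytopal_complex ?E"
    by (rule polytopal_subcomplex[OF poly]) (auto dest: face_of_imp_subset)
  moreover have "x \<in> \<Union>?E" if x: "x \<in> H" "H \<in> C1" for x H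
  proof -
    have "x \<in> \<Union>{F \<in> D. F \<subseteq> H}"
      using Union_cells_in[OF C D, of H] x C1(2) by blast
    then show ?thesis
      using x(2) by blast
  qed
  then have "\<Union>?E = \<Union>C1"
    by blast
  moreover have "\<exists>G\<in>C1. F \<subseteq> G" if F: "F \<in> ?E" for F
  proof -
    obtain x where x: "x \<in> rel_interior F"
      using rel_interior_nonempty_cell[OF poly] F by blast
    then obtain G where G: "G \<in> C1" "x \<in> G"
      using F rel_interior_subset by blast
    then show ?thesis
      using subdivision_cell_subset[OF C D _ _ x G(2)] F C1(2) by blast
  qed
  ultimately show ?thesis
    unfolding subdivision_of_def underlying_def by blast
qed

text \<open>As \<open>t\<close> grows, closest points nearly maximise \<open>w\<close> on
  \<open>F\<close>, so they stay above level \<open>\<beta>\<close>. In the inner product, the term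
  \<open>- t * (w \<bullet> x - \<beta>)\<close> then outweighs the bounded rest.\<close>

lemma eventually_far_center_beyond:
  fixes F :: "'a::euclidean_space set"
  assumes "compact F" "z \<in> F" "\<beta> < w \<bullet> z" "w \<bullet> y = \<beta>"
  shows "\<forall>\<^sub>F t in at_top. \<beta> < w \<bullet> closest_point F (t *\<^sub>R w) \<and>
    (t *\<^sub>R w - closest_point F (t *\<^sub>R w)) \<bullet> (y - closest_point F (t *\<^sub>R w)) < 0"
proof -
  have cl: "closed F"
    using assms(1) by (rule compact_imp_closed)
  obtain B where B: "\<And>u. u \<in> F \<Longrightarrow> norm u \<le> B" "norm y \<le> B" "0 < B"
  proof -
    obtain B0 where B0: "0 < B0" "\<And>u. u \<in> insert y F \<Longrightarrow> norm u \<le> B0"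
      using compact_imp_bounded[OF assms(1)] bounded_insert[of y F] unfolding bounded_pos by blast
    then show thesis
      using that by blast
  qed
  have ineq: "\<beta> < w \<bullet> closest_point F (t *\<^sub>R w) \<and>
      (t *\<^sub>R w - closest_point F (t *\<^sub>R w)) \<bullet> (y - closest_point F (t *\<^sub>R w)) < 0"
    \<comment> \<open>Of the three units \<open>B\<^sup>2\<close>, one covers the loss from
      \<open>z\<close> to the closest point and two bound the inner product of that point with
      \<open>y - ?x\<close>.\<close>
    if t: "0 < t" "3 * B\<^sup>2 / (w \<bullet> z - \<beta>) < t" for t
  proof -
    let ?x = "closest_point F (t *\<^sub>R w)"
    have x: "norm ?x \<le> B"
      using B(1) closest_point_in_set[OF cl] assms(2) by blast
    have "t * (2 * (w \<bullet> z - w \<bullet> ?x)) \<le> z \<bullet> z - ?x \<bullet> ?x"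
      using closest_point_dist_sq[OF cl assms(2), of "t *\<^sub>R w"] by (simp add: algebra_simps)
    also have "z \<bullet> z \<le> B\<^sup>2"
      using B(1)[OF assms(2)] by (simp add: dot_square_norm power_mono)
    finally have 1: "t * (2 * (w \<bullet> z - w \<bullet> ?x)) \<le> B\<^sup>2"
      using inner_ge_zero[of ?x] by linarith
    have 2: "3 * B\<^sup>2 < t * (w \<bullet> z - \<beta>)"
      using t(2) assms(3) by (simp add: divide_simps)
    have split: "t * (w \<bullet> ?x - \<beta>) = t * (w \<bullet> z - \<beta>) - t * (w \<bullet> z - w \<bullet> ?x)"
      by (simp add: algebra_simps)
    have "0 \<le> B\<^sup>2"
      by simp
    have 3: "2 * B\<^sup>2 < t * (w \<bullet> ?x - \<beta>)"
      using 1 2 split \<open>0 \<le> B\<^sup>2\<close> by linarith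
    then have "0 < t * (w \<bullet> ?x - \<beta>)"
      using \<open>0 \<le> B\<^sup>2\<close> by linarith
    then have "\<beta> < w \<bullet> ?x"
      using t(1) by (simp add: zero_less_mult_iff)
    moreover have "- (?x \<bullet> (y - ?x)) \<le> 2 * B\<^sup>2"
    proof -
      have "\<bar>?x \<bullet> (y - ?x)\<bar> \<le> norm ?x * norm (y - ?x)"
        by (rule Cauchy_Schwarz_ineq2)
      also have "\<dots> \<le> B * (B + B)"
        using x B(2,3) norm_triangle_ineq4[of y ?x] by (intro mult_mono) auto
      finally show ?thesis
        by (simp add: power2_eq_square)
    qed
    moreover have "(t *\<^sub>R w - ?x) \<bullet> (y - ?x) = - (t * (w \<bullet> ?x - \<beta>)) - ?x \<bullet> (y - ?x)"
      using assms(4) by (simp add: inner_simps algebra_simps)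
    ultimately show ?thesis
      using 3 by linarith
  qed
  have "\<forall>\<^sub>F t in at_top. 0 < t \<and> 3 * B\<^sup>2 / (w \<bullet> z - \<beta>) < t"
    by (intro eventually_conj eventually_gt_at_top)
  then show ?thesis
    by (rule eventually_mono) (use ineq in blast)
qed

section \<open>A single elementary collapse\<close>

text \<open>Chains in \<open>\<tau>\<close> are grouped by their members inside
  \<open>\<sigma>\<close>. If there are none, the sweep from a far centre applies. Otherwise the
  rest of the chain consists of cells not in \<open>\<sigma>\<close> above the largest such member
  \<open>F\<close>; these form the open link of a relative interior point of \<open>F\<close> along
  the inner normal, and one slicing suffices.\<close>

theorem collapses_away_elementary:
  fixes C :: "'a::euclidean_space set set"
  assumes C: "polytopal_complex C" and collapse: "elementary_collapse C C1" and D: "subdivision_of D C"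
  shows "collapses_away {c \<in> chains_of D. \<exists>F\<in>c. \<not> F \<subseteq> \<Union>C1}"
proof -
  have poly: "polytopal_complex D"
    using D unfolding subdivision_of_def by blast
  obtain \<sigma> where free: "free_face C \<sigma>" and C1_def: "C1 = C - {G \<in> C. \<sigma> \<subseteq> G}"
    using collapse unfolding elementary_collapse_def by blast
  have \<sigma>: "\<sigma> \<in> C" "\<sigma> \<noteq> {}" and ex1: "\<exists>!\<tau>. \<tau> \<in> C \<and> \<sigma> \<subset> \<tau>"
    using free unfolding free_face_def by simp_all
  then obtain \<tau> where \<tau>: "\<tau> \<in> C" "\<sigma> \<subset> \<tau>"
    by blast
  have unique: "G = \<tau>" if "G \<in> C" "\<sigma> \<subset> G" for G
    using ex1 \<tau> that by blast
  have C1: "H \<in> C \<and> \<not> \<sigma> \<subseteq> H" if "H \<in> C1" for H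
    using that unfolding C1_def by blast
  have not_C1: "H = \<sigma> \<or> H = \<tau>" if "H \<in> C" "H \<notin> C1" for H
    using that unique[of H] unfolding C1_def by blast
  have cvx: "convex \<sigma>" "convex \<tau>"
    using polytopal_complexD(4)[OF C] \<sigma> \<tau> by blast+
  have poly\<tau>: "polytope \<tau>" "polyhedron \<tau>"
    using polytopal_complexD(2)[OF C \<tau>(1)] polytope_imp_polyhedron by blast+

  have "\<sigma> \<inter> \<tau> = \<sigma>"
    using \<tau>(2) by blast
  then have "\<sigma> face_of \<tau>"
    using polytopal_complexD(6)[OF C \<sigma>(1) \<tau>(1)] by simp
  then have "\<sigma> exposed_face_of \<tau>"
    using exposed_face_of_polyhedron[OF poly\<tau>(2)] by blast
  then obtain a b where "\<tau> \<subseteq> {x. a \<bullet> x \<le> b}" "\<sigma> = \<tau> \<inter> {x. a \<bullet> x = b}"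
    unfolding exposed_face_of_def by blast
  \<comment> \<open>The signs are switched so that \<open>w\<close> is an inner normal:
    \<open>\<sigma>\<close> is the face of \<open>\<tau>\<close> where \<open>w\<close> is
    least.\<close>
  then obtain w \<beta> where w: "\<And>z. z \<in> \<tau> \<Longrightarrow> \<beta> \<le> w \<bullet> z" and w\<sigma>: "\<And>z. z \<in> \<sigma> \<longleftrightarrow> z \<in> \<tau> \<and> w \<bullet> z = \<beta>"
    by (intro that[of "- b" "- a"]) auto

  define E where "E = {F \<in> D. F \<subseteq> \<tau>}"
  define N where "N = {F \<in> E. \<not> F \<subseteq> \<sigma>}"
  have E: "cell_complex E"
    unfolding E_def by (rule cell_complex_restrict[OF poly])
  have UE: "\<Union>E = \<tau>"
    unfolding E_def by (rule Union_cells_in[OF C D \<tau>(1)])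
  have cvxE: "convex (\<Union>E)"
    using UE cvx(2) by simp
  have in_\<tau>: "F \<subseteq> \<tau>" if "F \<in> E" for F
    using that by (simp add: E_def)
  have "N \<subseteq> E"
    by (auto simp: N_def)
  have avoid: "\<not> S \<subseteq> \<Union>C1" if S: "x \<in> S" "x \<in> rel_interior T" "T \<in> C" "\<sigma> \<subseteq> T" for S T x
  proof
    assume "S \<subseteq> \<Union>C1"
    then obtain H where H: "H \<in> C1" "x \<in> H"
      using S(1) by blast
    have "T \<subseteq> H"
      by (rule cell_subset_if_meets[OF C _ S(3) order_refl S(2) H(2)]) (use C1 H in blast)
    then show False
      using C1[OF H(1)] S(4) by blast
  qed
  \<comment> \<open>A cell in the relative boundary of \<open>\<tau>\<close> lies in a proper face;
    not being inside \<open>\<sigma>\<close>, it has a face other than \<open>\<sigma>\<close>,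
    which survives in \<open>C1\<close>.\<close>
  have interior_iff: "\<not> F \<subseteq> \<Union>C1 \<longleftrightarrow> F \<inter> rel_interior (\<Union>E) \<noteq> {}" if F: "F \<in> N" for F
  proof
    assume "F \<inter> rel_interior (\<Union>E) \<noteq> {}"
    then obtain p where "p \<in> F" "p \<in> rel_interior \<tau>"
      unfolding UE by blast
    then show "\<not> F \<subseteq> \<Union>C1"
      using avoid \<tau> by blast
  next
    assume nsub: "\<not> F \<subseteq> \<Union>C1"
    show "F \<inter> rel_interior (\<Union>E) \<noteq> {}"
    proof
      assume empty: "F \<inter> rel_interior (\<Union>E) = {}"
      have FE: "F \<in> E" "F \<subseteq> \<tau>"
        using F in_\<tau> \<open>N \<subseteq> E\<close> by auto
      obtain p where p: "p \<in> rel_interior F"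
        using rel_interior_nonempty_cell[OF poly] FE(1) unfolding E_def by blast
      then have "p \<in> F" "p \<in> \<tau>" "p \<notin> rel_interior \<tau>"
        using FE(2) empty rel_interior_subset UE by blast+
      then have "p \<in> rel_frontier \<tau>"
        using closure_subset by (auto simp: rel_frontier_def)
      then obtain H where H: "H face_of \<tau>" "H \<noteq> \<tau>" "p \<in> H"
        unfolding rel_frontier_of_polyhedron_alt[OF poly\<tau>(2)] by blast
      have "F \<subseteq> H"
        using subset_of_face_of[OF H(1) FE(2)] H(3) p by blast
      then have "H \<noteq> \<sigma>"
        using F unfolding N_def by blast
      moreover have "H \<in> C"
        using polytopal_complexD(5)[OF C \<tau>(1) H(1)] H(3) by blast
      ultimately have "H \<in> C1"
        using not_C1 H(2) by blast
      then show False
        using nsub \<open>F \<subseteq> H\<close> by blast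
    qed
  qed

  have off_\<sigma>: "\<exists>z\<in>F. \<beta> < w \<bullet> z" if F: "F \<in> N" for F
  proof -
    obtain z where z: "z \<in> F" "z \<notin> \<sigma>"
      using F unfolding N_def by blast
    then have "z \<in> \<tau>"
      using F \<open>N \<subseteq> E\<close> in_\<tau> by blast
    then have "\<beta> < w \<bullet> z"
      using w[of z] w\<sigma>[of z] z(2) by (simp add: order_less_le)
    then show ?thesis
      using z(1) by blast
  qed

  have "collapses_away {c \<in> chains_of N. \<exists>F\<in>c. F \<inter> rel_interior (\<Union>E) \<noteq> {}}"
  proof -
    obtain y where y: "y \<in> \<sigma>"
      using \<sigma>(2) by blast
    have y\<tau>: "y \<in> \<Union>E" "w \<bullet> y = \<beta>"
      using y w\<sigma> UE by auto
    have "\<forall>\<^sub>F t in at_top. \<beta> < w \<bullet> closest_point F (t *\<^sub>R w) \<and>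
        (t *\<^sub>R w - closest_point F (t *\<^sub>R w)) \<bullet> (y - closest_point F (t *\<^sub>R w)) < 0" if F: "F \<in> N" for F
    proof -
      have "compact F"
        using polytopal_complexD(2)[OF poly, of F] F polytope_imp_compact unfolding N_def E_def by blast
      then show ?thesis
        using off_\<sigma>[OF F] eventually_far_center_beyond y\<tau>(2) by blast
    qed
    moreover have "finite N"
      using cell_complexD(1)[OF E] \<open>N \<subseteq> E\<close> finite_subset by blast
    ultimately have "\<forall>\<^sub>F t in at_top. \<forall>F\<in>N. \<beta> < w \<bullet> closest_point F (t *\<^sub>R w) \<and>
        (t *\<^sub>R w - closest_point F (t *\<^sub>R w)) \<bullet> (y - closest_point F (t *\<^sub>R w)) < 0"
      by (simp add: eventually_ball_finite)
    from eventually_happens'[OF trivial_limit_at_top_linorder this]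
    \<comment> \<open>The first property keeps the carriers of closest points out of
      \<open>\<sigma>\<close>; the second makes \<open>y\<close> the point on the side away from the
      centre.\<close>
    obtain c where c: "\<And>F. F \<in> N \<Longrightarrow> \<beta> < w \<bullet> closest_point F c"
      "\<And>F. F \<in> N \<Longrightarrow> (c - closest_point F c) \<bullet> (y - closest_point F c) < 0"
      by blast
    show ?thesis
    proof (rule collapses_away_interior_chains[OF E cvxE \<open>N \<subseteq> E\<close>])
      show "G \<in> N" if "F \<in> N" "G \<in> E" "F \<subseteq> G" for F G
        using that unfolding N_def by blast
      show "G \<in> N" if "F \<in> N" "G \<in> E" "closest_point F c \<in> rel_interior G" for F G
      proof -
        have "closest_point F c \<in> G" "closest_point F c \<notin> \<sigma>"
          using that(3) rel_interior_subset c(1)[OF that(1)] w\<sigma> by auto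
        then show ?thesis
          using that(2) unfolding N_def by blast
      qed
      show "\<exists>y\<in>\<Union>E. (c - closest_point F c) \<bullet> (y - closest_point F c) < 0" if "F \<in> N" for F
        using c(2)[OF that] y\<tau>(1) by blast
    next
      fix G x assume G: "G \<in> N" and x: "x = closest_point G c" "x \<in> rel_interior G" "x \<notin> rel_interior (\<Union>E)"
      let ?L = "open_link x (c - x) E"
      have xE: "x \<in> \<Union>E"
        using x(2) G \<open>N \<subseteq> E\<close> rel_interior_subset by blast
      show "collapses_away {b \<in> chains_of ?L. \<exists>F\<in>b. F \<inter> rel_interior (\<Union>E) \<noteq> {}}"
      proof (cases "?L = {}")
        case False
        then obtain v where v: "v \<in> \<Union>E" "0 < (c - x) \<bullet> (v - x)"
          by (auto simp: open_link_def)
        have "(c - x) \<bullet> (y - x) < 0"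
          using c(2)[OF G] x(1) by simp
        then obtain \<rho> where "\<rho> \<in> tangent_cone x (\<Union>E)" "(c - x) \<bullet> \<rho> = 0" "- \<rho> \<notin> tangent_cone x (\<Union>E)"
          using tangent_direction_in_hyperplane[OF cvxE xE x(3) y\<tau>(1) _ v] by blast
        then have "recedes (slice x (c - x) (\<Union>E))"
          by (rule recedes_slice[OF E cvxE xE])
        then show ?thesis
          using Union_slice[OF E cvxE xE, of "c - x"] convex_slice[OF cvxE xE, of "c - x"]
          by (intro collapses_away_boundary_link[OF E cvxE xE] collapses_away_receding cell_complex_slice E) simp_all
      qed (rule collapses_away_trivial_link)
    qed
  qed
  moreover have "{c \<in> chains_of N. \<exists>F\<in>c. F \<inter> rel_interior (\<Union>E) \<noteq> {}} = {c \<in> chains_of N. \<exists>F\<in>c. \<not> F \<subseteq> \<Union>C1}"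
  proof (intro Collect_cong conj_cong refl bex_cong)
    fix c F assume "c \<in> chains_of N" "F \<in> c"
    then show "F \<inter> rel_interior (\<Union>E) \<noteq> {} \<longleftrightarrow> \<not> F \<subseteq> \<Union>C1"
      using chains_ofD(1)[of c N] interior_iff[of F] by blast
  qed
  ultimately have far: "collapses_away {c \<in> chains_of N. \<exists>F\<in>c. \<not> F \<subseteq> \<Union>C1}"
    by (simp only:)

  \<comment> \<open>On \<open>\<tau>\<close> the form \<open>w\<close> exceeds
    \<open>\<beta>\<close> exactly off \<open>\<sigma>\<close>, so entering the open half-space
    means not lying in \<open>\<sigma>\<close>.\<close>
  have link_eq: "open_link x w E = {G \<in> N. F \<subseteq> G}" if F: "F \<in> E" "F \<subseteq> \<sigma>" "x \<in> rel_interior F" for F x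
  proof (intro equalityI subsetI)
    have x: "x \<in> F" "x \<in> \<sigma>" "w \<bullet> x = \<beta>"
      using F rel_interior_subset w\<sigma> by blast+
    {
      fix G assume "G \<in> open_link x w E"
      then obtain y where G: "G \<in> E" "x \<in> G" "y \<in> G" "0 < w \<bullet> (y - x)"
        unfolding open_link_def by blast
      then have "y \<notin> \<sigma>"
        using x(3) w\<sigma>[of y] by (auto simp: inner_simps)
      then show "G \<in> {G \<in> N. F \<subseteq> G}"
        using G cell_complexD(6)[OF E F(1) G(1) F(3) G(2)] unfolding N_def by blast
    next
      fix G assume G: "G \<in> {G \<in> N. F \<subseteq> G}"
      then obtain y where "y \<in> G" "\<beta> < w \<bullet> y"
        using off_\<sigma> by blast
      then show "G \<in> open_link x w E"
        using G x \<open>N \<subseteq> E\<close> unfolding open_link_def by (auto simp: inner_simps intro!: bexI[of _ y])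
    }
  qed

  have near: "collapses_away {b \<in> chains_of {G \<in> N. F \<subseteq> G}. \<not> F \<subseteq> \<Union>C1 \<or> (\<exists>G\<in>b. \<not> G \<subseteq> \<Union>C1)}"
    if F: "F \<in> E" "F \<subseteq> \<sigma>" for F
  proof -
    obtain x where x: "x \<in> rel_interior F"
      using rel_interior_nonempty_cell[OF poly] F(1) unfolding E_def by blast
    have xF: "x \<in> F" "x \<in> \<sigma>" "x \<in> \<tau>" "w \<bullet> x = \<beta>"
      using x F(2) rel_interior_subset w\<sigma> by blast+
    have xE: "x \<in> \<Union>E"
      using xF UE by simp
    let ?L = "open_link x w E"
    have slices: "cell_complex (slice x w ` ?L)" "\<Union>(slice x w ` ?L) = slice x w (\<Union>E)" "convex (\<Union>(slice x w ` ?L))"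
      using cell_complex_slice[OF E] Union_slice[OF E cvxE xE] convex_slice[OF cvxE xE] by simp_all
    show ?thesis
    proof (cases "F \<subseteq> \<Union>C1")
      case False
      obtain z where "z \<in> \<tau>" "z \<notin> \<sigma>"
        using \<tau>(2) by blast
      then have "0 < w \<bullet> (z - x)"
        using w[of z] w\<sigma>[of z] xF(4) by (auto simp: inner_simps)
      then have "?L \<noteq> {}"
        using open_link_nonempty[OF E cvxE xE] UE \<open>z \<in> \<tau>\<close> by blast
      then have "collapses_away (chains_of (slice x w ` ?L))"
        using slices by (intro collapses_away_convex) auto
      then have "collapses_away (chains_of ?L)"
        by (rule collapses_away_chains_of_open_link[OF E])
      moreover have "{b \<in> chains_of ?L. \<not> F \<subseteq> \<Union>C1 \<or> (\<exists>G\<in>b. \<not> G \<subseteq> \<Union>C1)} = chains_of ?L"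
        using False by auto
      ultimately show ?thesis
        unfolding link_eq[OF F x] by (simp only:)
    next
      case True
      have "x \<notin> rel_interior \<sigma>"
        using avoid[OF xF(1) _ \<sigma>(1) order_refl] True by blast
      then obtain y where y: "y \<in> \<sigma>" "\<And>s. 0 < s \<Longrightarrow> x - s *\<^sub>R (y - x) \<notin> \<sigma>"
        using not_rel_interior_direction[OF cvx(1) xF(2)] by blast
      have wy: "w \<bullet> (y - x) = 0" "y \<in> \<Union>E"
        using y(1) w\<sigma> xF(4) UE by (auto simp: inner_simps)
      \<comment> \<open>The direction \<open>y - x\<close> cannot be reversed within
        \<open>\<sigma>\<close>; moving against it keeps \<open>w\<close> at level
        \<open>\<beta>\<close>, where \<open>\<tau>\<close> has only the points of
        \<open>\<sigma>\<close>.\<close>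
      have "- (y - x) \<notin> tangent_cone x (\<Union>E)"
      proof
        assume "- (y - x) \<in> tangent_cone x (\<Union>E)"
        then obtain s where s: "0 < s" "x + s *\<^sub>R - (y - x) \<in> \<tau>"
          unfolding tangent_cone_def UE by blast
        then have "x - s *\<^sub>R (y - x) \<in> \<tau>"
          by (simp only: scaleR_minus_right diff_conv_add_uminus)
        moreover have "w \<bullet> (x - s *\<^sub>R (y - x)) = \<beta>"
          using wy(1) xF(4) by (simp only: inner_diff_right inner_scaleR_right)
        ultimately show False
          using y(2)[OF s(1)] w\<sigma> by blast
      qed
      then have "recedes (slice x w (\<Union>E))"
        using recedes_slice[OF E cvxE xE tangent_cone_diff[OF wy(2)] wy(1)] by blast
      then have "collapses_away {b \<in> chains_of ?L. \<exists>G\<in>b. G \<inter> rel_interior (\<Union>E) \<noteq> {}}"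
        using slices by (intro collapses_away_boundary_link[OF E cvxE xE] collapses_away_receding) simp_all
      moreover have "{b \<in> chains_of ?L. \<exists>G\<in>b. G \<inter> rel_interior (\<Union>E) \<noteq> {}} =
          {b \<in> chains_of ?L. \<not> F \<subseteq> \<Union>C1 \<or> (\<exists>G\<in>b. \<not> G \<subseteq> \<Union>C1)}"
      proof (intro Collect_cong conj_cong refl)
        fix b assume "b \<in> chains_of ?L"
        then have "G \<in> N" if "G \<in> b" for G
          using that chains_ofD(1)[of b ?L] link_eq[OF F x] by blast
        then have "(\<exists>G\<in>b. G \<inter> rel_interior (\<Union>E) \<noteq> {}) \<longleftrightarrow> (\<exists>G\<in>b. \<not> G \<subseteq> \<Union>C1)"
          by (intro bex_cong refl) (simp only: interior_iff)
        then show "(\<exists>G\<in>b. G \<inter> rel_interior (\<Union>E) \<noteq> {}) \<longleftrightarrow> \<not> F \<subseteq> \<Union>C1 \<or> (\<exists>G\<in>b. \<not> G \<subseteq> \<Union>C1)"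
          using True by (simp only: not_True_eq_False simp_thms)
      qed
      ultimately show ?thesis
        unfolding link_eq[OF F x] by (simp only:)
    qed
  qed

  let ?X = "{c \<in> chains_of E. \<exists>F\<in>c. \<not> F \<subseteq> \<Union>C1}"
  define S where "S = E - N"
  have S: "F \<in> E" "F \<subseteq> \<sigma>" if "F \<in> S" for F
    using that unfolding S_def N_def by blast+
  have "collapses_away ?X"
  proof (rule collapses_away_fibres[where h = "\<lambda>c. c \<inter> S" and r = card])
    show "finite ?X"
      using finite_chains_of[OF cell_complexD(1)[OF E]] by simp
    fix c c' assume c: "c \<in> ?X" "c' \<in> ?X" "c \<subseteq> c'"
    have fin: "finite (c' \<inter> S)"
      using finite_chain[OF cell_complexD(1)[OF E], of c'] c(2) by blast
    have sub: "c \<inter> S \<subseteq> c' \<inter> S"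
      using c(3) by blast
    show "card (c \<inter> S) \<le> card (c' \<inter> S)"
      by (rule card_mono[OF fin sub])
    show "c \<inter> S = c' \<inter> S" if "card (c \<inter> S) = card (c' \<inter> S)"
      by (rule card_subset_eq[OF fin sub that])
  next
    fix i assume "i \<in> (\<lambda>c. c \<inter> S) ` ?X"
    then obtain c0 where c0: "c0 \<in> chains_of E" "i = c0 \<inter> S"
      by blast
    show "collapses_away {c \<in> ?X. c \<inter> S = i}"
    proof (cases "i = {}")
      case True
      have "{c \<in> ?X. c \<inter> S = i} = {c \<in> chains_of N. \<exists>F\<in>c. \<not> F \<subseteq> \<Union>C1}"
        unfolding True S_def using \<open>N \<subseteq> E\<close> by (auto simp: chains_of_def)
      then show ?thesis
        using far by (simp only:)
    next
      case False
      have i: "i \<in> chains_of E" "i \<subseteq> S"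
        using c0 chains_of_subset by blast+
      have "finite i"
        using finite_chain[OF cell_complexD(1)[OF E] i(1)] .
      define F where "F = \<Union>i"
      have Fi: "F \<in> i"
        unfolding F_def by (rule Union_in_chain[OF \<open>finite i\<close> False i(1)])
      have F: "F \<in> E" "F \<subseteq> \<sigma>"
        using S Fi i(2) by blast+
      let ?B = "{b \<in> chains_of {G \<in> N. F \<subseteq> G}. \<not> F \<subseteq> \<Union>C1 \<or> (\<exists>G\<in>b. \<not> G \<subseteq> \<Union>C1)}"
      have le_F: "G \<subseteq> F" if "G \<in> i" for G
        using that unfolding F_def by blast
      have "{c \<in> ?X. c \<inter> S = i} = (\<union>) i ` ?B"
      proof (intro equalityI subsetI)
        fix c assume "c \<in> {c \<in> ?X. c \<inter> S = i}"
        then have c: "c \<in> chains_of E" "\<exists>G\<in>c. \<not> G \<subseteq> \<Union>C1" "c \<inter> S = i"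
          by auto
        have "G \<in> N \<and> F \<subseteq> G" if G: "G \<in> c - S" for G
        proof -
          have "G \<in> N"
            using G chains_ofD(1)[OF c(1)] unfolding S_def by blast
          then have "\<not> G \<subseteq> F"
            using F(2) unfolding N_def by blast
          then show ?thesis
            using \<open>G \<in> N\<close> chains_ofD(2)[OF c(1), of F G] G Fi c(3) by blast
        qed
        then have "c - S \<in> chains_of {G \<in> N. F \<subseteq> G}"
          using chains_ofD(2)[OF c(1)] by (intro chains_ofI) auto
        moreover have "\<not> F \<subseteq> \<Union>C1 \<or> (\<exists>G\<in>c - S. \<not> G \<subseteq> \<Union>C1)"
          using c(2,3) le_F by blast
        moreover have "c = i \<union> (c - S)"
          using c(3) by blast
        ultimately show "c \<in> (\<union>) i ` ?B"
          by blast
      next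
        fix c assume "c \<in> (\<union>) i ` ?B"
        then obtain b where b: "b \<in> chains_of {G \<in> N. F \<subseteq> G}" "\<not> F \<subseteq> \<Union>C1 \<or> (\<exists>G\<in>b. \<not> G \<subseteq> \<Union>C1)"
          and c: "c = i \<union> b"
          by blast
        have bN: "G \<in> N" "F \<subseteq> G" if "G \<in> b" for G
          using that chains_ofD(1)[OF b(1)] by blast+
        have "c \<in> chains_of E"
        proof (rule chains_ofI)
          show "c \<subseteq> E"
            using chains_ofD(1)[OF i(1)] bN(1) \<open>N \<subseteq> E\<close> unfolding c by blast
          show "G \<subseteq> H \<or> H \<subseteq> G" if "G \<in> c" "H \<in> c" for G H
            using that chains_ofD(2)[OF i(1), of G H] chains_ofD(2)[OF b(1), of G H]
              le_F[of G] le_F[of H] bN(2)[of G] bN(2)[of H] unfolding c by blast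
        qed
        moreover have "c \<inter> S = i"
          using i(2) bN(1) unfolding c S_def by blast
        moreover have "\<exists>G\<in>c. \<not> G \<subseteq> \<Union>C1"
          using b(2) Fi unfolding c by blast
        ultimately show "c \<in> {c \<in> ?X. c \<inter> S = i}"
          by blast
      qed
      moreover have "collapses_away ((\<union>) i ` ?B)"
      proof (rule collapses_away_join[OF near[OF F]])
        show "i \<inter> b = {}" if "b \<in> ?B" for b
          using that chains_ofD(1)[of b "{G \<in> N. F \<subseteq> G}"] i(2) unfolding S_def by blast
      qed
      ultimately show ?thesis
        by (simp only:)
    qed
  qed
  moreover have "{c \<in> chains_of D. \<exists>F\<in>c. \<not> F \<subseteq> \<Union>C1} = ?X"
  proof (intro equalityI subsetI)
    fix c assume c: "c \<in> {c \<in> chains_of D. \<exists>F\<in>c. \<not> F \<subseteq> \<Union>C1}"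
    then have cD: "c \<in> chains_of D"
      by blast
    obtain F where F: "F \<in> c" "\<not> F \<subseteq> \<Union>C1"
      using c by blast
    \<comment> \<open>Only \<open>\<sigma>\<close> and \<open>\<tau>\<close> are lost from
      \<open>C\<close>, so a cell outside \<open>\<Union>C1\<close> lies in \<open>\<tau>\<close>.
      Any chain member above such a cell is again outside, so the whole chain lies in
      \<open>\<tau>\<close>.\<close>
    have top: "G \<subseteq> \<tau>" if "G \<in> c" "\<not> G \<subseteq> \<Union>C1" for G
    proof -
      have "G \<in> D"
        using chains_ofD(1)[OF cD] \<open>G \<in> c\<close> by blast
      then obtain H where "H \<in> C" "G \<subseteq> H"
        using D unfolding subdivision_of_def by blast
      then show ?thesis
        using not_C1[of H] that(2) \<tau>(2) by blast
    qed
    have "G \<subseteq> \<tau>" if "G \<in> c" for G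
      using chains_ofD(2)[OF cD that F(1)] top[OF that] top[OF F] F(2) by blast
    then have "c \<in> chains_of E"
      using chains_ofD[OF cD] unfolding E_def by (intro chains_ofI) auto
    then show "c \<in> ?X"
      using F by blast
  next
    fix c assume "c \<in> ?X"
    then show "c \<in> {c \<in> chains_of D. \<exists>F\<in>c. \<not> F \<subseteq> \<Union>C1}"
      using chains_of_mono[of c E D] unfolding E_def by blast
  qed
  ultimately show ?thesis
    by (simp only:)
qed

text \<open>Chains leaving \<open>\<Union>C1\<close> are removed first; they form an upper set. What
  remains are chains of the subdivision induced on \<open>C1\<close>, to which the rest of the
  collapse applies.\<close>

theorem collapses_away_subdivision:
  fixes C :: "'a::euclidean_space set set"
  assumes "collapses_to C C'" "polytopal_complex C" "subdivision_of D C"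
  shows "C' \<subseteq> C \<and> polytopal_complex C' \<and> collapses_away {c \<in> chains_of D. \<exists>F\<in>c. \<not> F \<subseteq> \<Union>C'}"
  using assms unfolding collapses_to_def
proof (induction C arbitrary: D rule: converse_rtranclp_induct)
  case base
  have "F \<subseteq> \<Union>C'" if "c \<in> chains_of D" "F \<in> c" for c F
    using that chains_ofD(1)[of c D] base.prems(2) unfolding subdivision_of_def underlying_def by blast
  then have "{c \<in> chains_of D. \<exists>F\<in>c. \<not> F \<subseteq> \<Union>C'} = {}"
    by blast
  then have "collapses_away {c \<in> chains_of D. \<exists>F\<in>c. \<not> F \<subseteq> \<Union>C'}"
    by (simp only: collapses_away.empty)
  then show ?case
    using base.prems(1) by blast
next
  case (step C C1)
  have C1: "polytopal_complex C1" "C1 \<subseteq> C"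
    using polytopal_complex_elementary_collapse[OF step.prems(1) step.hyps(1)] step.hyps(1)
    unfolding elementary_collapse_def by blast+
  define D1 where "D1 = {F \<in> D. F \<subseteq> \<Union>C1}"
  have "subdivision_of D1 C1"
    unfolding D1_def by (rule subdivision_of_subcomplex[OF step.prems C1])
  then have IH: "C' \<subseteq> C1" "polytopal_complex C'"
    "collapses_away {c \<in> chains_of D1. \<exists>F\<in>c. \<not> F \<subseteq> \<Union>C'}" (is "collapses_away ?Z")
    using step.IH[OF C1(1)] by blast+
  have Y: "collapses_away {c \<in> chains_of D. \<exists>F\<in>c. \<not> F \<subseteq> \<Union>C1}" (is "collapses_away ?Y")
    by (rule collapses_away_elementary[OF step.prems(1) step.hyps(1) step.prems(2)])
  have Z: "F \<subseteq> \<Union>C1" if "c \<in> ?Z" "F \<in> c" for c F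
    using that chains_ofD(1)[of c D1] unfolding D1_def by blast
  have "collapses_away (?Y \<union> ?Z)"
  proof (rule collapses_away_Un[OF Y IH(3)])
    show "?Y \<inter> ?Z = {}"
      using Z by blast
    show "\<not> y \<subseteq> z" if "y \<in> ?Y" "z \<in> ?Z" for y z
      using Z[OF that(2)] that(1) by blast
  qed
  moreover have "?Y \<union> ?Z = {c \<in> chains_of D. \<exists>F\<in>c. \<not> F \<subseteq> \<Union>C'}"
  proof (intro equalityI subsetI)
    fix c assume "c \<in> ?Y \<union> ?Z"
    then show "c \<in> {c \<in> chains_of D. \<exists>F\<in>c. \<not> F \<subseteq> \<Union>C'}"
    proof
      assume "c \<in> ?Y"
      then show ?thesis
        using IH(1) by blast
    next
      assume "c \<in> ?Z"
      then show ?thesis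
        using chains_of_mono[of c D1 D] unfolding D1_def by blast
    qed
  next
    fix c assume c: "c \<in> {c \<in> chains_of D. \<exists>F\<in>c. \<not> F \<subseteq> \<Union>C'}"
    show "c \<in> ?Y \<union> ?Z"
    proof (cases "\<exists>F\<in>c. \<not> F \<subseteq> \<Union>C1")
      case False
      have cD: "c \<in> chains_of D"
        using c by blast
      have "c \<in> chains_of D1"
        using False chains_ofD(1)[OF cD] chains_ofD(2)[OF cD] unfolding D1_def by (intro chains_ofI) auto
      then show ?thesis
        using c by blast
    qed (use c in blast)
  qed
  ultimately have "collapses_away {c \<in> chains_of D. \<exists>F\<in>c. \<not> F \<subseteq> \<Union>C'}"
    by (simp only:)
  moreover have "C' \<subseteq> C"
    using IH(1) C1(2) by (rule subset_trans)
  ultimately show ?case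
    using IH(2) by (intro conjI)
qed

section \<open>Derived subdivisions as order complexes\<close>

text \<open>The complex reached from \<open>D\<close> after the stellar subdivisions at the cells in \<open>A\<close>;
  the case \<open>G = {}\<close> covers the simplices all of whose vertices are new.\<close>

definition partial_derived :: "('a::euclidean_space set \<Rightarrow> 'a) \<Rightarrow> 'a set set \<Rightarrow> 'a set set \<Rightarrow> 'a set set" where
  "partial_derived p D A = {convex hull (G \<union> p ` c) | G c.
     (G \<in> D - A \<or> G = {}) \<and> c \<in> chains_of A \<and> (\<forall>F\<in>c. G \<subseteq> F) \<and> (G \<noteq> {} \<or> c \<noteq> {})}"

text \<open>A point with positive weight on the vertex of the largest member \<open>T\<close> is in
  the relative interior of \<open>T\<close>; with weight zero it belongs to the hull for a shorter
  chain.\<close>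

lemma convex_hull_chain_cases:
  fixes G :: "'a::euclidean_space set"
  assumes "finite c" "c \<in> chains_of D" "\<And>F. F \<in> c \<Longrightarrow> convex F \<and> p F \<in> rel_interior F"
    and "convex G" "\<And>F. F \<in> c \<Longrightarrow> G \<subseteq> F" "z \<in> convex hull (G \<union> p ` c)"
  shows "z \<in> G \<or> (\<exists>F\<in>c. z \<in> rel_interior F)"
  using assms
proof (induction "card c" arbitrary: c z)
  case 0
  then show ?case
    by (simp add: convex_hull_eq hull_same)
next
  case (Suc n)
  define T where "T = \<Union>c"
  have ne: "c \<noteq> {}"
    using Suc.hyps(2) by auto
  have T: "T \<in> c"
    unfolding T_def by (rule Union_in_chain[OF Suc.prems(1) ne Suc.prems(2)])
  have pT: "convex T" "p T \<in> rel_interior T"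
    using Suc.prems(3)[OF T] by blast+
  let ?c = "c - {T}"
  have n: "n = card ?c"
    using Suc.hyps(2) T Suc.prems(1) by simp
  have "G \<union> p ` c = insert (p T) (G \<union> p ` ?c)"
    using T by blast
  then have z: "z \<in> convex hull (insert (p T) (G \<union> p ` ?c))"
    using Suc.prems(6) by simp
  show ?case
  proof (cases "G \<union> p ` ?c = {}")
    case True
    then have "z = p T"
      using z by (simp only: True convex_hull_singleton singleton_iff)
    then show ?thesis
      using T pT by blast
  next
    case False
    then obtain u v b where uv: "0 \<le> u" "0 \<le> v" "u + v = 1" and b: "b \<in> convex hull (G \<union> p ` ?c)"
      and z_eq: "z = u *\<^sub>R p T + v *\<^sub>R b"
      using z unfolding convex_hull_insert[OF False] by blast
    show ?thesis
    proof (cases "u = 0")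
      case True
      then have "z = b"
        using uv z_eq by simp
      moreover have "b \<in> G \<or> (\<exists>F\<in>?c. b \<in> rel_interior F)"
        by (rule Suc.hyps(1)[OF n])
          (use Suc.prems b chains_of_subset[OF Suc.prems(2), of ?c] in auto)
      ultimately show ?thesis
        by blast
    next
      case False
      have "p F \<in> T" if "F \<in> c" for F
        using Suc.prems(3)[OF that] that rel_interior_subset unfolding T_def by blast
      then have "G \<union> p ` ?c \<subseteq> T"
        using Suc.prems(5)[OF T] by blast
      then have "b \<in> T"
        using b hull_minimal[of "G \<union> p ` ?c" T convex] pT(1) by blast
      then have "b - u *\<^sub>R (b - p T) \<in> rel_interior T"
        using False uv by (intro rel_interior_convex_shrink pT) auto
      also have "b - u *\<^sub>R (b - p T) = u *\<^sub>R p T + (1 - u) *\<^sub>R b"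
        by (simp add: algebra_simps)
      also have "1 - u = v"
        using uv(3) by linarith
      also have "u *\<^sub>R p T + v *\<^sub>R b = z"
        using z_eq by simp
      finally show ?thesis
        using T by blast
    qed
  qed
qed

section \<open>Stellar subdivisions in terms of chains\<close>

locale derivation =
  fixes D :: "'a::euclidean_space set set" and p :: "'a set \<Rightarrow> 'a"
  assumes poly: "polytopal_complex D" and p: "\<And>F. F \<in> D \<Longrightarrow> p F \<in> rel_interior F"
begin

lemma carrier_eq: "\<lbrakk>F \<in> D; G \<in> D; x \<in> rel_interior F; x \<in> rel_interior G\<rbrakk> \<Longrightarrow> F = G"
  using cell_subset_if_meets[OF poly, of F G G x] cell_subset_if_meets[OF poly, of G F F x]
    rel_interior_subset by blast

lemma subset_if_meets: "\<lbrakk>F \<in> D; G \<in> D; x \<in> rel_interior F; x \<in> G\<rbrakk> \<Longrightarrow> F \<subseteq> G"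
  using cell_subset_if_meets[OF poly, of G F F x] by blast

lemma hull_cases:
  assumes "c \<in> chains_of D" "G \<in> D \<or> G = {}" "\<forall>F\<in>c. G \<subseteq> F" "z \<in> convex hull (G \<union> p ` c)"
  shows "z \<in> G \<or> (\<exists>F\<in>c. z \<in> rel_interior F)"
proof (rule convex_hull_chain_cases[OF _ assms(1) _ _ _ assms(4)])
  show "G \<subseteq> F" if "F \<in> c" for F
    using assms(3) that by blast
  show "finite c"
    using finite_chain[OF polytopal_complexD(1)[OF poly] assms(1)] .
  show "convex F \<and> p F \<in> rel_interior F" if "F \<in> c" for F
    using p polytopal_complexD(4)[OF poly] chains_ofD(1)[OF assms(1)] that by blast
  show "convex G"
    using assms(2) polytopal_complexD(4)[OF poly] by auto
qed

text \<open>The new vertex of \<open>F\<close> determines \<open>F\<close> as its carrier, so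
  simplices remember their chains.\<close>

lemma vertex_in_hull_iff:
  assumes "c \<in> chains_of D" "F \<in> D"
  shows "p F \<in> convex hull (p ` c) \<longleftrightarrow> F \<in> c"
proof
  assume "p F \<in> convex hull (p ` c)"
  then obtain G where G: "G \<in> c" "p F \<in> rel_interior G"
    using hull_cases[OF assms(1), of "{}" "p F"] by auto
  then have "F = G"
    using carrier_eq[OF assms(2) _ p[OF assms(2)] G(2)] chains_ofD(1)[OF assms(1)] by blast
  then show "F \<in> c"
    using G(1) by simp
qed (simp add: hull_inc)

lemma hull_subset_iff:
  assumes "c \<in> chains_of D" "c' \<in> chains_of D"
  shows "convex hull (p ` c) \<subseteq> convex hull (p ` c') \<longleftrightarrow> c \<subseteq> c'"
proof
  assume le: "convex hull (p ` c) \<subseteq> convex hull (p ` c')"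
  show "c \<subseteq> c'"
  proof
    fix F assume "F \<in> c"
    then have "F \<in> D" "p F \<in> convex hull (p ` c')"
      using chains_ofD(1)[OF assms(1)] le hull_inc[of "p F" "p ` c" convex] by blast+
    then show "F \<in> c'"
      using vertex_in_hull_iff[OF assms(2)] by blast
  qed
qed (intro hull_mono image_mono)

lemma partial_derived_empty: "partial_derived p D {} = D"
proof -
  have "convex hull G = G" if "G \<in> D" for G
    using polytopal_complexD(4)[OF poly that] by (rule hull_same)
  moreover have "G \<noteq> {}" if "G \<in> D" for G
    using polytopal_complexD(3)[OF poly that] .
  moreover have "chains_of {} = {{}}"
    by (auto simp: chains_of_def)
  then have "X \<in> partial_derived p D {} \<longleftrightarrow> (\<exists>G\<in>D. G \<noteq> {} \<and> X = convex hull G)" for X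
    unfolding partial_derived_def by auto
  ultimately show ?thesis
    by (intro equalityI subsetI) force+
qed

lemma partial_derived_all: "partial_derived p D D = (\<lambda>c. convex hull (p ` c)) ` (chains_of D - {{}})"
  unfolding partial_derived_def by auto

text \<open>By the order of dimensions no treated cell lies in \<open>F\<close>, and no untreated
  cell strictly contains \<open>F\<close>. The faces containing \<open>F\<close> are therefore the
  hulls of \<open>F\<close> with chains of treated cells above it, and coning from
  \<open>p F\<close> replaces \<open>F\<close> by a smaller \<open>G\<close> and lengthens the chain
  by \<open>F\<close>.\<close>

lemma stellar_partial_derived:
  assumes A: "A \<subseteq> D" and F: "F \<in> D - A"
    and dims: "\<And>G. G \<in> A \<Longrightarrow> aff_dim F \<le> aff_dim G" "\<And>G. G \<in> D - A \<Longrightarrow> aff_dim G \<le> aff_dim F"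
  shows "stellar (partial_derived p D A) F (p F) = partial_derived p D (insert F A)"
proof -
  let ?K = "partial_derived p D A" and ?h = "\<lambda>G c. convex hull (G \<union> p ` c)"
  define ok where "ok G c \<longleftrightarrow> (G \<in> D - A \<or> G = {}) \<and> c \<in> chains_of A \<and> (\<forall>F\<in>c. G \<subseteq> F)" for G c
  have K: "X \<in> ?K \<longleftrightarrow> (\<exists>G c. X = ?h G c \<and> ok G c \<and> (G \<noteq> {} \<or> c \<noteq> {}))" for X
    unfolding partial_derived_def ok_def by blast
  have FD: "F \<in> D" "F \<noteq> {}" "p F \<in> rel_interior F" "p F \<in> F" and FA: "F \<notin> A"
    using F p polytopal_complexD(3)[OF poly] rel_interior_subset by blast+
  have eq_dim: "G = H" if "G \<in> D" "H \<in> D" "G \<subseteq> H" "aff_dim H \<le> aff_dim G" for G H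
  proof (rule ccontr)
    assume "G \<noteq> H"
    have "G \<inter> H = G"
      using that(3) by blast
    then have "G face_of H"
      using polytopal_complexD(6)[OF poly that(1,2)] by simp
    then show False
      using face_of_aff_dim_lt[of H G] polytopal_complexD(4)[OF poly that(2)] \<open>G \<noteq> H\<close> that(4) by simp
  qed
  have below: "\<not> G \<subseteq> F" if "G \<in> A" for G
    using eq_dim[of G F] dims(1)[OF that] that A FA FD(1) by blast
  have above: "G = F" if "G \<in> D - A" "F \<subseteq> G" for G
    using eq_dim[of F G] dims(2)[OF that(1)] that FD(1) by blast
  have okD: "c \<in> chains_of D" "G \<in> D \<or> G = {}" "\<forall>H\<in>c. G \<subseteq> H" "\<And>H. H \<in> c \<Longrightarrow> H \<in> A"
    if "ok G c" for G c
    using that chains_of_mono[OF _ A] chains_ofD(1)[of c A] unfolding ok_def by blast+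
  have F_sub: "F \<subseteq> ?h G c \<longleftrightarrow> G = F" if ok: "ok G c" for G c
  proof
    assume "F \<subseteq> ?h G c"
    then have "p F \<in> ?h G c"
      using FD(4) by blast
    then have "p F \<in> G \<or> (\<exists>H\<in>c. p F \<in> rel_interior H)"
      by (rule hull_cases[OF okD(1-3)[OF ok]])
    then have "p F \<in> G"
      using carrier_eq[OF FD(1) _ FD(3)] okD(4)[OF ok] A FA by blast
    then have "G \<in> D - A" "F \<subseteq> G"
      using ok subset_if_meets[OF FD(1) _ FD(3)] unfolding ok_def by blast+
    then show "G = F"
      by (rule above)
  next
    assume "G = F"
    then show "F \<subseteq> ?h G c"
      using hull_subset[of "G \<union> p ` c" convex] by blast
  qed
  \<comment> \<open>Carriers recover both parts of a face: points of \<open>G\<close> cannot lie in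
    the relative interior of a treated cell, and the vertex of a treated cell cannot lie in
    \<open>F\<close>.\<close>
  have sub_star: "G \<subseteq> F \<and> c \<subseteq> c'" if ok: "ok G c" "ok F c'" and le: "?h G c \<subseteq> ?h F c'" for G c c'
  proof
    have *: "z \<in> F \<or> (\<exists>H\<in>c'. z \<in> rel_interior H)" if "z \<in> ?h G c" for z
      using hull_cases[OF okD(1-3)[OF ok(2)]] le that by blast
    show "G \<subseteq> F"
    proof (cases "G = {}")
      case False
      then have G: "G \<in> D - A"
        using ok(1) unfolding ok_def by blast
      then obtain z where z: "z \<in> rel_interior G"
        using rel_interior_nonempty_cell[OF poly] by blast
      have "z \<in> G"
        using z rel_interior_subset by blast
      then have "z \<in> ?h G c"
        by (simp add: hull_inc)
      then consider "z \<in> F" | H where "H \<in> c'" "z \<in> rel_interior H"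
        using * by blast
      then show ?thesis
      proof cases
        case 1
        then show ?thesis
          using subset_if_meets[OF _ FD(1) z] G by blast
      next
        case 2
        then have "G = H"
          using carrier_eq[OF _ _ z] G okD(4)[OF ok(2)] A by blast
        then show ?thesis
          using G okD(4)[OF ok(2) 2(1)] by blast
      qed
    qed simp
    show "c \<subseteq> c'"
    proof
      fix H assume H: "H \<in> c"
      then have HA: "H \<in> A" "H \<in> D" "p H \<in> rel_interior H"
        using okD(4)[OF ok(1)] A p by blast+
      have "p H \<in> ?h G c"
        using H by (simp add: hull_inc)
      then consider "p H \<in> F" | H' where "H' \<in> c'" "p H \<in> rel_interior H'"
        using * by blast
      then show "H \<in> c'"
      proof cases
        case 1
        then show ?thesis
          using subset_if_meets[OF HA(2) FD(1) HA(3)] below[OF HA(1)] by blast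
      next
        case 2
        then have "H = H'"
          using carrier_eq[OF HA(2) _ HA(3)] okD(4)[OF ok(2)] A by blast
        then show ?thesis
          using 2(1) by simp
      qed
    qed
  qed
  have cone: "convex hull (insert (p F) (?h G c)) = ?h G (insert F c)" for G c
  proof -
    have "convex hull (insert (p F) (?h G c)) = convex hull ({p F} \<union> (G \<union> p ` c))"
      using hull_Un_right[of convex "{p F}" "G \<union> p ` c"] by simp
    then show ?thesis
      by simp
  qed

  define ok' where "ok' G c \<longleftrightarrow> (G \<in> D - insert F A \<or> G = {}) \<and> c \<in> chains_of (insert F A) \<and> (\<forall>H\<in>c. G \<subseteq> H)" for G c
  have K': "X \<in> partial_derived p D (insert F A) \<longleftrightarrow> (\<exists>G c. X = ?h G c \<and> ok' G c \<and> (G \<noteq> {} \<or> c \<noteq> {}))" for X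
    unfolding partial_derived_def ok'_def by blast
  have ok'_without: "ok' G c \<longleftrightarrow> ok G c \<and> G \<noteq> F" if "F \<notin> c" for G c
    using that FD(2) unfolding ok_def ok'_def chains_of_def by blast
  have ok'_with: "ok' G (insert F c) \<longleftrightarrow> ok G c \<and> ok F c \<and> G \<subseteq> F \<and> G \<noteq> F" if "F \<notin> c" for G c
  proof
    assume ok': "ok' G (insert F c)"
    have ch: "insert F c \<in> chains_of (insert F A)"
      using ok' unfolding ok'_def by blast
    have cA: "c \<subseteq> A"
      using chains_ofD(1)[OF ch] that by blast
    then have "c \<in> chains_of A"
      using chains_ofD(2)[OF ch] by (intro chains_ofI) blast+
    moreover have "F \<subseteq> H" if "H \<in> c" for H
      using chains_ofD(2)[OF ch, of F H] below[of H] that cA by blast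
    ultimately show "ok G c \<and> ok F c \<and> G \<subseteq> F \<and> G \<noteq> F"
      using ok' F FD(2) unfolding ok_def ok'_def by blast
  next
    assume ok: "ok G c \<and> ok F c \<and> G \<subseteq> F \<and> G \<noteq> F"
    have c: "c \<in> chains_of A"
      using ok unfolding ok_def by blast
    have "insert F c \<in> chains_of (insert F A)"
    proof (rule insert_in_chains_of)
      show "c \<in> chains_of (insert F A)"
        by (rule chains_of_mono[OF c]) blast
    qed (use ok in \<open>auto simp: ok_def\<close>)
    then show "ok' G (insert F c)"
      using ok unfolding ok_def ok'_def by blast
  qed
  show ?thesis
  proof (intro equalityI subsetI)
    fix X assume "X \<in> stellar ?K F (p F)"
    then consider "X \<in> ?K" "\<not> F \<subseteq> X"
      | Y H where "X = convex hull (insert (p F) Y)" "Y \<in> ?K" "\<not> F \<subseteq> Y" "H \<in> ?K" "F \<subseteq> H" "Y \<subseteq> H"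
      | "X = {p F}"
      unfolding stellar_def by blast
    then show "X \<in> partial_derived p D (insert F A)"
    proof cases
      case 1
      then obtain G c where X: "X = ?h G c" "ok G c" "G \<noteq> {} \<or> c \<noteq> {}"
        using K by blast
      then have "G \<noteq> F" "F \<notin> c"
        using 1(2) F_sub FA okD(4) by blast+
      then show ?thesis
        using X ok'_without K' by blast
    next
      case 2
      obtain G c where Y: "Y = ?h G c" "ok G c"
        using 2(2) K by blast
      obtain G' c' where H: "H = ?h G' c'" "ok G' c'"
        using 2(4) K by blast
      have GF: "G \<noteq> F" "G' = F"
        using F_sub 2(3,5) Y H by blast+
      have sub: "G \<subseteq> F" "c \<subseteq> c'"
        using sub_star[of G c c'] 2(6) Y H GF by blast+
      have "ok F c"
        using H(2) GF(2) Y(2) sub(2) unfolding ok_def by blast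
      moreover have "F \<notin> c"
        using FA okD(4)[OF Y(2)] by blast
      ultimately have "ok' G (insert F c)"
        using ok'_with Y(2) sub(1) GF(1) by blast
      then show ?thesis
        using 2(1) Y(1) cone K' by blast
    next
      \<comment> \<open>The separate \<open>{p}\<close> in \<open>stellar\<close> is the simplex
        with \<open>G = {}\<close> and the chain \<open>{F}\<close>. Coning does not produce it,
        since the faces of the complex are nonempty.\<close>
      case 3
      have "ok {} {}" "ok F {}"
        using F unfolding ok_def chains_of_def by blast+
      then have "ok' {} {F}"
        using ok'_with[of "{}" "{}"] FD(2) by blast
      moreover have "X = ?h {} {F}"
        using 3 by simp
      ultimately show ?thesis
        using K' by blast
    qed
  next
    fix X assume "X \<in> partial_derived p D (insert F A)"
    then obtain G c where X: "X = ?h G c" "ok' G c" "G \<noteq> {} \<or> c \<noteq> {}"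
      using K' by blast
    show "X \<in> stellar ?K F (p F)"
    proof (cases "F \<in> c")
      case False
      then have ok: "ok G c" "G \<noteq> F"
        using X(2) ok'_without by blast+
      then have "X \<in> ?K" "\<not> F \<subseteq> X"
        using X(1,3) K F_sub by blast+
      then show ?thesis
        unfolding stellar_def by blast
    next
      case True
      define b where "b = c - {F}"
      have b: "c = insert F b" "F \<notin> b"
        using True unfolding b_def by blast+
      have ok: "ok G b" "ok F b" "G \<subseteq> F" "G \<noteq> F"
        using X(2) ok'_with b by blast+
      show ?thesis
      proof (cases "G = {} \<and> b = {}")
        case True
        then have "X = {p F}"
          using X(1) b(1) by simp
        then show ?thesis
          unfolding stellar_def by blast
      next
        case False
        have "?h G b \<in> ?K" "?h F b \<in> ?K"
          using ok False FD(2) K by blast+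
        moreover have "\<not> F \<subseteq> ?h G b" "F \<subseteq> ?h F b"
          using F_sub ok by blast+
        moreover have "?h G b \<subseteq> ?h F b"
          using ok(3) by (intro hull_mono) blast
        moreover have "X = convex hull (insert (p F) (?h G b))"
          using X(1) b(1) cone by simp
        ultimately show ?thesis
          unfolding stellar_def by blast
      qed
    qed
  qed
qed

lemma foldl_stellar:
  assumes "distinct (xs @ ys)" "set (xs @ ys) = D" "sorted_wrt (\<lambda>F G. aff_dim G \<le> aff_dim F) (xs @ ys)"
  shows "foldl (\<lambda>K F. stellar K F (p F)) D xs = partial_derived p D (set xs)"
  using assms
proof (induction xs arbitrary: ys rule: rev_induct)
  case Nil
  then show ?case
    by (simp add: partial_derived_empty)
next
  case (snoc F xs)
  have "foldl (\<lambda>K F. stellar K F (p F)) D xs = partial_derived p D (set xs)"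
    using snoc.prems by (intro snoc.IH[of "F # ys"]) simp_all
  moreover have "stellar (partial_derived p D (set xs)) F (p F) = partial_derived p D (insert F (set xs))"
    using snoc.prems by (intro stellar_partial_derived) (auto simp: sorted_wrt_append)
  ultimately show ?case
    by simp
qed

end

lemma derived_subdivision_eq:
  assumes "polytopal_complex D" "derived_subdivision D S"
  obtains p where "\<And>F. F \<in> D \<Longrightarrow> p F \<in> rel_interior F"
    and "S = (\<lambda>c. convex hull (p ` c)) ` (chains_of D - {{}})"
proof -
  obtain fs p where fs: "distinct fs" "set fs = D" "sorted_wrt (\<lambda>F G. aff_dim G \<le> aff_dim F) fs"
    and p: "\<And>F. F \<in> D \<Longrightarrow> p F \<in> rel_interior F" and S: "S = foldl (\<lambda>K F. stellar K F (p F)) D fs"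
    using assms(2) unfolding derived_subdivision_def by blast
  interpret derivation D p
    using assms(1) p by unfold_locales
  have "S = partial_derived p D D"
    unfolding S using foldl_stellar[of fs "[]"] fs by simp
  then show thesis
    by (intro that[of p]) (simp_all add: p partial_derived_all)
qed

theorem theorem2p3:
  fixes C C' D SD :: "'a::euclidean_space set set"
  assumes "polytopal_complex C"
    and "polytopal_complex C'"
    and "C' \<subseteq> C"
    and "collapses_to C C'"
    and "subdivision_of D C"
    and "derived_subdivision D SD"
  shows "collapses_to SD
           (restrict_complex SD (underlying (restrict_complex D (underlying C'))))"
proof -
  have poly: "polytopal_complex D"
    using assms(5) unfolding subdivision_of_def by blast
  obtain p where p: "\<And>F. F \<in> D \<Longrightarrow> p F \<in> rel_interior F"
    and SD: "SD = (\<lambda>c. convex hull (p ` c)) ` (chains_of D - {{}})"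
    using derived_subdivision_eq[OF poly assms(6)] by blast
  interpret derivation D p
    using poly p by unfold_locales
  let ?h = "\<lambda>c. convex hull (p ` c)"
  define X where "X = {c \<in> chains_of D. \<exists>F\<in>c. \<not> F \<subseteq> \<Union>C'}"
  define D' where "D' = {F \<in> D. F \<subseteq> \<Union>C'}"
  have X: "c \<in> chains_of D" "c \<noteq> {}" if "c \<in> X" for c
    using that unfolding X_def by blast+
  have ca: "collapses_away (?h ` X)"
  proof (rule collapses_away_image)
    show "collapses_away X"
      unfolding X_def using collapses_away_subdivision[OF assms(4,1,5)] by blast
  qed (rule hull_subset_iff[OF X(1) X(1)])
  have "collapses_to SD (SD - ?h ` X)"
  proof (rule collapses_to_if_collapses_away[OF ca])
    show "?h ` X \<subseteq> SD"
      unfolding SD using X by blast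
    have "?h c \<noteq> {}" if "c \<in> X" for c
      using X(2)[OF that] by simp
    then show "{} \<notin> ?h ` X"
      by blast
  next
    fix S T assume "S \<in> ?h ` X" "T \<in> SD" "S \<subseteq> T"
    then obtain c c' where c: "c \<in> X" "S = ?h c" and c': "c' \<in> chains_of D" "T = ?h c'"
      unfolding SD by blast
    then have "c \<subseteq> c'"
      using hull_subset_iff[OF X(1)[OF c(1)] c'(1)] \<open>S \<subseteq> T\<close> by blast
    then have "c' \<in> X"
      using c(1) c'(1) unfolding X_def by blast
    then show "T \<in> ?h ` X"
      using c'(2) by blast
  qed
  moreover have "SD - ?h ` X = restrict_complex SD (\<Union>D')"
  proof -
    \<comment> \<open>In one direction the vertices \<open>p F\<close> force each cell of the chain
      into a cell of \<open>D'\<close>; in the other the largest cell of the chain contains the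
      whole simplex.\<close>
    have inside: "?h c \<subseteq> \<Union>D' \<longleftrightarrow> c \<notin> X" if c: "c \<in> chains_of D - {{}}" for c
    proof
      assume sub: "?h c \<subseteq> \<Union>D'"
      have "F \<subseteq> \<Union>C'" if "F \<in> c" for F
      proof -
        have F: "F \<in> D"
          using that c chains_ofD(1) by blast
        have "p F \<in> ?h c"
          using that by (simp add: hull_inc)
        then obtain G where G: "G \<in> D'" "p F \<in> G"
          using sub by blast
        then have "F \<subseteq> G"
          using subset_if_meets[OF F _ p[OF F]] unfolding D'_def by blast
        then show ?thesis
          using G(1) unfolding D'_def by blast
      qed
      then show "c \<notin> X"
        unfolding X_def by blast
    next
      assume "c \<notin> X"
      have ch: "c \<in> chains_of D" "c \<noteq> {}" "finite c"
        using c finite_chain[OF polytopal_complexD(1)[OF poly]] by blast+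
      have T: "\<Union>c \<in> c"
        by (rule Union_in_chain[OF ch(3,2,1)])
      then have "\<Union>c \<in> D'"
        using \<open>c \<notin> X\<close> ch(1) chains_ofD(1)[OF ch(1)] unfolding X_def D'_def by blast
      moreover have "p ` c \<subseteq> \<Union>c"
        using p chains_ofD(1)[OF ch(1)] rel_interior_subset by blast
      then have "?h c \<subseteq> \<Union>c"
        using polytopal_complexD(4)[OF poly, of "\<Union>c"] T chains_ofD(1)[OF ch(1)]
        by (intro hull_minimal) auto
      ultimately show "?h c \<subseteq> \<Union>D'"
        by blast
    qed
    show ?thesis
    proof (intro equalityI subsetI)
      fix S assume "S \<in> SD - ?h ` X"
      then obtain c where "c \<in> chains_of D - {{}}" "S = ?h c" "c \<notin> X" "S \<in> SD"
        unfolding SD by blast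
      then show "S \<in> restrict_complex SD (\<Union>D')"
        using inside unfolding restrict_complex_def by blast
    next
      fix S assume S: "S \<in> restrict_complex SD (\<Union>D')"
      have "?h c \<notin> restrict_complex SD (\<Union>D')" if "c \<in> X" for c
        using inside[of c] X[OF that] that unfolding restrict_complex_def by blast
      then show "S \<in> SD - ?h ` X"
        using S unfolding restrict_complex_def by blast
    qed
  qed
  ultimately show ?thesis
    unfolding restrict_complex_def underlying_def D'_def by simp
qed

end
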